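(* Let $(\Phi,G)$ and $(\Psi,H)$ be perception pairs with $\mathrm{dom}(\Phi)=X$ and $\mathrm{dom}(\Psi)=Y$, let $T:G\to H$ be a group homomorphism, and let $\mathcal{F}\subseteq\mathcal{F}^{\mathrm{all}}_T$ be a collectionwise surjective space of GENEOs $(F,T):(\Phi,G)\to(\Psi,H)$. If the data sets $\Phi$ and $\Psi$ are totally bounded and endow $X$ and $Y$ with metric structures (i.e. $D_X$ and $D_Y$ are metrics), then $\mathcal{F}$ admits a compactification $\mathcal{F}^*$.
   Context: Let $X$ be a non-empty set and let $\mathbb{R}^X_b$ be the space of bounded functions $X\to\mathbb{R}$ with the uniform norm $\|\cdot\|_\infty$. A data set on $X$ is a subset $\Phi\subseteq\mathbb{R}^X_b$ with the metric $D_\Phi(\varphi_1,\varphi_2)=\|\varphi_1-\varphi_2\|_\infty$; one writes $\mathrm{dom}(\Phi)=X$. The set $X$ is given the extended pseudo-metric $D_X(x_1,x_2)=\sup_{\varphi\in\Phi}|\varphi(x_1)-\varphi(x_2)|$ (and similarly $D_Y$ for a data set $\Psi$ on $Y$). $\mathrm{Aut}_\Phi(X)$ is the group (under composition) of all bijections $g:X\to X$ such that $\varphi\circ g\in\Phi$ and $\varphi\circ g^{-1}\in\Phi$ for all $\varphi\in\Phi$. It carries the (extended) pseudo-metric $D_{\mathrm{Aut}}(g,h)=\sup_{\varphi\in\Phi}D_\Phi(\varphi g,\varphi h)$. A perception pair $(\Phi,G)$ consists of such a $\Phi$ and a subgroup $G$ of $\mathrm{Aut}_\Phi(X)$, with $G$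 carrying the restriction of $D_{\mathrm{Aut}}$. A perception pair $(\Phi,G)$ with $\mathrm{dom}(\Phi)=X$ is compact if $\Phi$, $G$ and $X$ (with respect to $D_\Phi$, $D_{\mathrm{Aut}}$, $D_X$) are all compact. A compactification of a perception pair $(\Phi,G)$ with $\mathrm{dom}(\Phi)=X$ is a compact perception pair $(\Phi^*,G^* )$ with $\mathrm{dom}(\Phi^* )=X^*$ together with isometric (distance-preserving) embeddings $j:X\to X^*$, $i:\Phi\to\Phi^*$, $k:G\to G^*$ with dense images, such that $i(\varphi)\circ j=\varphi$ for every $\varphi\in\Phi$ and $k(g)\circ j=j\circ g$ for every $g\in G$. For a group homomorphism $T:G\to H$, a map $F:\Phi\to\Psi$ is a group equivariant non-expansive operator (GENEO) with respect to $T$, written $(F,T):(\Phi,G)\to(\Psi,H)$, if $F(\varphi\circ g)=F(\varphi)\circ T(g)$ for all $\varphi\in\Phi$, $g\in G$, and $\|F(\varphi_1)-F(\varphi_2)\|_\infty\le\|\varphi_1-\varphi_2\|_\infty$ for all $\varphi_1,\varphi_2\in\Phi$. $\mathcal{F}^{\mathrm{all}}_T$ is the set of all GENEOs $(F,T):(\Phi,G)\to(\Psi,H)$, with the metric $D_{\mathrm{GENEO}}(F_1,F_2)=\sup_{\varphi\in\Phi}D_\Psi(F_1(\varphi),F_2(\varphi))$. A space $\mathcal{F}\subseteq\mathcal{F}^{\mathrm{all}}_T$ is collectionwise surjective if $\bigcup_{F\in\mathcal{F}}F(\Phi)=\Psi$. A compactification of a space $\mathcal{F}\subseteq\mathcal{F}^{\mathrm{all}}_T$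 of GENEOs $(F,T):(\Phi,G)\to(\Psi,H)$ is a compact space $\mathcal{F}^*\subseteq\mathcal{F}^{\mathrm{all}}_{T^*}$ of GENEOs $(F^*,T^* ):(\Phi^*,G^* )\to(\Psi^*,H^* )$ (with $\mathrm{dom}(\Phi^* )=X^*$, $\mathrm{dom}(\Psi^* )=Y^*$, and $T^*:G^*\to H^*$ a group homomorphism) such that $(\Phi^*,G^* )$ and $(\Psi^*,H^* )$ are compactifications of $(\Phi,G)$ and $(\Psi,H)$, with embeddings $(j_1,i_1,k_1)$ and $(j_2,i_2,k_2)$ respectively, and there is an isometric embedding $f:\mathcal{F}\to\mathcal{F}^*$ with dense image satisfying $i_2\circ F=f(F)\circ i_1$ for each $F\in\mathcal{F}$ and $k_2\circ T=T^*\circ k_1$. *)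

theory Defs
  imports "HOL-Analysis.Analysis" "HOL-Algebra.Bij"
begin

section \<open>Extended pseudo-metrics\<close>

text \<open>
  The distances on points, on group elements and on operators are suprema that may vanish on
  distinct elements or be infinite, so \<^locale>\<open>Metric_space\<close> does not apply. An extended
  pseudo-metric on a carrier \<open>S\<close> is a function into \<^typ>\<open>ennreal\<close>, so that a supremum over the
  empty set is \<open>0\<close>.
\<close>

definition epm_topology :: "'a set \<Rightarrow> ('a \<Rightarrow> 'a \<Rightarrow> ennreal) \<Rightarrow> 'a topology" where
  "epm_topology S d =
     topology (\<lambda>U. U \<subseteq> S \<and> (\<forall>x\<in>U. \<exists>r>0. \<forall>y\<in>S. d x y < ennreal r \<longrightarrow> y \<in> U))"

lemma openin_epm_topology:
  "openin (epm_topology S d) U \<longleftrightarrow>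
     U \<subseteq> S \<and> (\<forall>x\<in>U. \<exists>r>0. \<forall>y\<in>S. d x y < ennreal r \<longrightarrow> y \<in> U)"
proof -
  let ?L = "\<lambda>U. U \<subseteq> S \<and> (\<forall>x\<in>U. \<exists>r>0. \<forall>y\<in>S. d x y < ennreal r \<longrightarrow> y \<in> U)"
  have "?L (U \<inter> V)" if U: "?L U" and V: "?L V" for U V
  proof (intro conjI ballI)
    show "U \<inter> V \<subseteq> S" using U by blast
    fix x assume x: "x \<in> U \<inter> V"
    obtain r where r: "r > 0" "\<forall>y\<in>S. d x y < ennreal r \<longrightarrow> y \<in> U" using U x by blast
    obtain s where s: "s > 0" "\<forall>y\<in>S. d x y < ennreal s \<longrightarrow> y \<in> V" using V x by blast
    have "d x y < ennreal r \<and> d x y < ennreal s" if "d x y < ennreal (min r s)" for y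
      using that by (meson ennreal_leI less_le_trans min.cobounded1 min.cobounded2)
    then show "\<exists>t>0. \<forall>y\<in>S. d x y < ennreal t \<longrightarrow> y \<in> U \<inter> V"
      using r s by (intro exI[of _ "min r s"]) auto
  qed
  moreover have "?L (\<Union>\<K>)" if "\<forall>K\<in>\<K>. ?L K" for \<K>
    using that by (meson Union_iff Union_least)
  ultimately have "istopology ?L"
    unfolding istopology_def by blast
  then show ?thesis
    by (simp add: epm_topology_def topology_inverse')
qed

lemma topspace_epm_topology [simp]: "topspace (epm_topology S d) = S"
proof
  show "topspace (epm_topology S d) \<subseteq> S"
    using openin_topspace[of "epm_topology S d"] unfolding openin_epm_topology by blast
  have "openin (epm_topology S d) S"
    unfolding openin_epm_topology by (auto intro: exI[of _ 1])
  then show "S \<subseteq> topspace (epm_topology S d)" by (rule openin_subset)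
qed

lemma (in Metric_space) epm_topology_eq_mtopology:
  "epm_topology M (\<lambda>x y. ennreal (d x y)) = mtopology"
proof -
  have "openin (epm_topology M (\<lambda>x y. ennreal (d x y))) U \<longleftrightarrow> openin mtopology U" for U
    unfolding openin_epm_topology openin_mtopology mball_def
    by (fastforce simp: ennreal_less_iff)
  then show ?thesis by (simp add: topology_eq)
qed

definition epm_compact :: "'a set \<Rightarrow> ('a \<Rightarrow> 'a \<Rightarrow> ennreal) \<Rightarrow> bool" where
  "epm_compact S d \<longleftrightarrow> compact_space (epm_topology S d)"

definition epm_is_metric :: "'a set \<Rightarrow> ('a \<Rightarrow> 'a \<Rightarrow> ennreal) \<Rightarrow> bool" where
  "epm_is_metric S d \<longleftrightarrow>
     (\<forall>x\<in>S. \<forall>y\<in>S. d x y < \<infinity>) \<and> Metric_space S (\<lambda>x y. enn2real (d x y))"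

definition dense_isometric_embedding ::
  "'a set \<Rightarrow> ('a \<Rightarrow> 'a \<Rightarrow> ennreal) \<Rightarrow> 'b set \<Rightarrow> ('b \<Rightarrow> 'b \<Rightarrow> ennreal) \<Rightarrow> ('a \<Rightarrow> 'b) \<Rightarrow> bool"
  where
  "dense_isometric_embedding S d S' d' f \<longleftrightarrow>
     f \<in> S \<rightarrow> S' \<and> inj_on f S \<and>
     (\<forall>x\<in>S. \<forall>y\<in>S. d' (f x) (f y) = d x y) \<and>
     epm_topology S' d' closure_of (f ` S) = S'"


section \<open>Data sets and perception pairs\<close>

text \<open>
  A function on a carrier \<open>X\<close> is represented by its extensional representative, and composition on
  \<open>X\<close> is \<^const>\<open>compose\<close>. The space of bounded functions \<open>X \<rightarrow> \<real>\<close> with its uniform metric is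
  \<open>Met_TC.fspace X\<close> with \<open>Met_TC.fdist X\<close>.
\<close>

definition data_set :: "'x set \<Rightarrow> ('x \<Rightarrow> real) set \<Rightarrow> bool" where
  "data_set X \<Phi> \<longleftrightarrow> X \<noteq> {} \<and> \<Phi> \<subseteq> Met_TC.fspace X"

definition D_data :: "'x set \<Rightarrow> ('x \<Rightarrow> real) \<Rightarrow> ('x \<Rightarrow> real) \<Rightarrow> ennreal" where
  "D_data X \<phi>\<^sub>1 \<phi>\<^sub>2 = ennreal (Met_TC.fdist X \<phi>\<^sub>1 \<phi>\<^sub>2)"

lemma data_set_iff:
  "data_set X \<Phi> \<longleftrightarrow> X \<noteq> {} \<and> (\<forall>\<phi>\<in>\<Phi>. \<phi> \<in> extensional X \<and> bounded (\<phi> ` X))"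
  by (auto simp: data_set_def Met_TC.fspace_def)

lemma fdist_data_set:
  assumes "data_set X \<Phi>" "\<phi>\<^sub>1 \<in> \<Phi>" "\<phi>\<^sub>2 \<in> \<Phi>"
  shows "Met_TC.fdist X \<phi>\<^sub>1 \<phi>\<^sub>2 = (SUP x\<in>X. \<bar>\<phi>\<^sub>1 x - \<phi>\<^sub>2 x\<bar>)"
  using assms by (auto simp: data_set_def Met_TC.fdist_def dist_real_def)

definition data_totally_bounded :: "'x set \<Rightarrow> ('x \<Rightarrow> real) set \<Rightarrow> bool" where
  "data_totally_bounded X \<Phi> \<longleftrightarrow>
     Metric_space.mtotally_bounded (Met_TC.fspace X) (Met_TC.fdist X) \<Phi>"

definition D_pt :: "('x \<Rightarrow> real) set \<Rightarrow> 'x \<Rightarrow> 'x \<Rightarrow> ennreal" where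
  "D_pt \<Phi> x\<^sub>1 x\<^sub>2 = (SUP \<phi>\<in>\<Phi>. ennreal \<bar>\<phi> x\<^sub>1 - \<phi> x\<^sub>2\<bar>)"

definition Aut_group :: "'x set \<Rightarrow> ('x \<Rightarrow> real) set \<Rightarrow> ('x \<Rightarrow> 'x) monoid" where
  "Aut_group X \<Phi> = BijGroup X
     \<lparr>carrier := {g \<in> Bij X. \<forall>\<phi>\<in>\<Phi>. compose X \<phi> g \<in> \<Phi> \<and> compose X \<phi> (inv\<^bsub>BijGroup X\<^esub> g) \<in> \<Phi>}\<rparr>"

lemma group_Aut_group:
  assumes "data_set X \<Phi>"
  shows "group (Aut_group X \<Phi>)"
proof -
  interpret B: group "BijGroup X" by (rule group_BijGroup)
  let ?A = "{g \<in> Bij X. \<forall>\<phi>\<in>\<Phi>. compose X \<phi> g \<in> \<Phi> \<and> compose X \<phi> (inv\<^bsub>BijGroup X\<^esub> g) \<in> \<Phi>}"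
  have carr: "carrier (BijGroup X) = Bij X" by (simp add: BijGroup_def)
  have mult: "g \<otimes>\<^bsub>BijGroup X\<^esub> h = compose X g h" if "g \<in> Bij X" "h \<in> Bij X" for g h
    using that by (simp add: BijGroup_def)
  have assoc: "compose X \<phi> (compose X g h) = compose X (compose X \<phi> g) h"
    if "h \<in> Bij X" for \<phi> :: "'a \<Rightarrow> real" and g h
    using compose_assoc[OF Bij_imp_funcset[OF that]] .
  have ext: "\<phi> \<in> extensional X" if "\<phi> \<in> \<Phi>" for \<phi>
    using assms that by (simp add: data_set_iff)
  have "subgroup ?A (BijGroup X)"
  proof (rule B.subgroupI)
    show "?A \<subseteq> carrier (BijGroup X)" by (auto simp: carr)
    have "\<one>\<^bsub>BijGroup X\<^esub> \<in> ?A"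
    proof -
      have "compose X \<phi> (\<lambda>x\<in>X. x) = \<phi>" if "\<phi> \<in> \<Phi>" for \<phi>
        by (rule extensionalityI[OF compose_extensional ext[OF that]]) (simp add: compose_def)
      moreover have "\<one>\<^bsub>BijGroup X\<^esub> = (\<lambda>x\<in>X. x)" by (simp add: BijGroup_def)
      ultimately show ?thesis using B.inv_one id_Bij[of X] by simp
    qed
    then show "?A \<noteq> {}" by blast
    show "inv\<^bsub>BijGroup X\<^esub> g \<in> ?A" if "g \<in> ?A" for g
      using that B.inv_closed[of g] B.inv_inv[of g] by (auto simp: carr)
    show "g \<otimes>\<^bsub>BijGroup X\<^esub> h \<in> ?A" if g: "g \<in> ?A" and h: "h \<in> ?A" for g h
    proof -
      have B: "g \<in> Bij X" "h \<in> Bij X" "inv\<^bsub>BijGroup X\<^esub> g \<in> Bij X" "inv\<^bsub>BijGroup X\<^esub> h \<in> Bij X"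
        using g h B.inv_closed by (auto simp: carr)
      have "inv\<^bsub>BijGroup X\<^esub> (compose X g h)
              = compose X (inv\<^bsub>BijGroup X\<^esub> h) (inv\<^bsub>BijGroup X\<^esub> g)"
        using B.inv_mult_group[of g h] B by (simp add: carr mult)
      then show ?thesis
        using g h B by (simp add: mult compose_Bij assoc)
    qed
  qed
  then show ?thesis
    unfolding Aut_group_def by (rule subgroup.subgroup_is_group[OF _ group_BijGroup])
qed

definition D_Aut :: "'x set \<Rightarrow> ('x \<Rightarrow> real) set \<Rightarrow> ('x \<Rightarrow> 'x) \<Rightarrow> ('x \<Rightarrow> 'x) \<Rightarrow> ennreal" where
  "D_Aut X \<Phi> g h = (SUP \<phi>\<in>\<Phi>. D_data X (compose X \<phi> g) (compose X \<phi> h))"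

definition perception_pair :: "'x set \<Rightarrow> ('x \<Rightarrow> real) set \<Rightarrow> ('x \<Rightarrow> 'x) set \<Rightarrow> bool" where
  "perception_pair X \<Phi> G \<longleftrightarrow> data_set X \<Phi> \<and> subgroup G (Aut_group X \<Phi>)"

definition perception_group ::
  "'x set \<Rightarrow> ('x \<Rightarrow> real) set \<Rightarrow> ('x \<Rightarrow> 'x) set \<Rightarrow> ('x \<Rightarrow> 'x) monoid" where
  "perception_group X \<Phi> G = Aut_group X \<Phi> \<lparr>carrier := G\<rparr>"

definition compact_perception_pair ::
  "'x set \<Rightarrow> ('x \<Rightarrow> real) set \<Rightarrow> ('x \<Rightarrow> 'x) set \<Rightarrow> bool" where
  "compact_perception_pair X \<Phi> G \<longleftrightarrow>
     perception_pair X \<Phi> G \<and>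
     epm_compact \<Phi> (D_data X) \<and> epm_compact G (D_Aut X \<Phi>) \<and> epm_compact X (D_pt \<Phi>)"

definition perception_pair_compactification ::
  "'x set \<Rightarrow> ('x \<Rightarrow> real) set \<Rightarrow> ('x \<Rightarrow> 'x) set \<Rightarrow>
   'z set \<Rightarrow> ('z \<Rightarrow> real) set \<Rightarrow> ('z \<Rightarrow> 'z) set \<Rightarrow>
   ('x \<Rightarrow> 'z) \<Rightarrow> (('x \<Rightarrow> real) \<Rightarrow> ('z \<Rightarrow> real)) \<Rightarrow> (('x \<Rightarrow> 'x) \<Rightarrow> ('z \<Rightarrow> 'z)) \<Rightarrow> bool" where
  "perception_pair_compactification X \<Phi> G X' \<Phi>' G' j i k \<longleftrightarrow>
     compact_perception_pair X' \<Phi>' G' \<and>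
     dense_isometric_embedding X (D_pt \<Phi>) X' (D_pt \<Phi>') j \<and>
     dense_isometric_embedding \<Phi> (D_data X) \<Phi>' (D_data X') i \<and>
     dense_isometric_embedding G (D_Aut X \<Phi>) G' (D_Aut X' \<Phi>') k \<and>
     (\<forall>\<phi>\<in>\<Phi>. \<forall>x\<in>X. i \<phi> (j x) = \<phi> x) \<and>
     (\<forall>g\<in>G. \<forall>x\<in>X. k g (j x) = j (g x))"


section \<open>Group equivariant non-expansive operators\<close>

text \<open>
  \<open>geneos X \<Phi> G Y \<Psi> T\<close> is the set of all operators for the fixed \<open>T\<close>; that \<open>T\<close> is a
  homomorphism is required separately wherever this set is used.
\<close>

definition geneos ::
  "'x set \<Rightarrow> ('x \<Rightarrow> real) set \<Rightarrow> ('x \<Rightarrow> 'x) set \<Rightarrow> 'y set \<Rightarrow> ('y \<Rightarrow> real) set \<Rightarrow>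
   (('x \<Rightarrow> 'x) \<Rightarrow> ('y \<Rightarrow> 'y)) \<Rightarrow> (('x \<Rightarrow> real) \<Rightarrow> ('y \<Rightarrow> real)) set" where
  "geneos X \<Phi> G Y \<Psi> T = {F \<in> \<Phi> \<rightarrow>\<^sub>E \<Psi>.
     (\<forall>\<phi>\<in>\<Phi>. \<forall>g\<in>G. F (compose X \<phi> g) = compose Y (F \<phi>) (T g)) \<and>
     (\<forall>\<phi>\<^sub>1\<in>\<Phi>. \<forall>\<phi>\<^sub>2\<in>\<Phi>. D_data Y (F \<phi>\<^sub>1) (F \<phi>\<^sub>2) \<le> D_data X \<phi>\<^sub>1 \<phi>\<^sub>2)}"

definition D_GENEO ::
  "('x \<Rightarrow> real) set \<Rightarrow> 'y set \<Rightarrow>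
   (('x \<Rightarrow> real) \<Rightarrow> ('y \<Rightarrow> real)) \<Rightarrow> (('x \<Rightarrow> real) \<Rightarrow> ('y \<Rightarrow> real)) \<Rightarrow> ennreal" where
  "D_GENEO \<Phi> Y F\<^sub>1 F\<^sub>2 = (SUP \<phi>\<in>\<Phi>. D_data Y (F\<^sub>1 \<phi>) (F\<^sub>2 \<phi>))"

definition collectionwise_surjective ::
  "('x \<Rightarrow> real) set \<Rightarrow> ('y \<Rightarrow> real) set \<Rightarrow> (('x \<Rightarrow> real) \<Rightarrow> ('y \<Rightarrow> real)) set \<Rightarrow> bool" where
  "collectionwise_surjective \<Phi> \<Psi> \<F> \<longleftrightarrow> (\<Union>F\<in>\<F>. F ` \<Phi>) = \<Psi>"

definition geneo_space_compactification ::
  "'x set \<Rightarrow> ('x \<Rightarrow> real) set \<Rightarrow> ('x \<Rightarrow> 'x) set \<Rightarrow>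
   'y set \<Rightarrow> ('y \<Rightarrow> real) set \<Rightarrow> ('y \<Rightarrow> 'y) set \<Rightarrow>
   (('x \<Rightarrow> 'x) \<Rightarrow> ('y \<Rightarrow> 'y)) \<Rightarrow> (('x \<Rightarrow> real) \<Rightarrow> ('y \<Rightarrow> real)) set \<Rightarrow>
   'z set \<Rightarrow> ('z \<Rightarrow> real) set \<Rightarrow> ('z \<Rightarrow> 'z) set \<Rightarrow>
   'w set \<Rightarrow> ('w \<Rightarrow> real) set \<Rightarrow> ('w \<Rightarrow> 'w) set \<Rightarrow>
   (('z \<Rightarrow> 'z) \<Rightarrow> ('w \<Rightarrow> 'w)) \<Rightarrow> (('z \<Rightarrow> real) \<Rightarrow> ('w \<Rightarrow> real)) set \<Rightarrow> bool" where
  "geneo_space_compactification X \<Phi> G Y \<Psi> H T \<F> X' \<Phi>' G' Y' \<Psi>' H' T' \<F>' \<longleftrightarrow>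
     T' \<in> hom (perception_group X' \<Phi>' G') (perception_group Y' \<Psi>' H') \<and>
     \<F>' \<subseteq> geneos X' \<Phi>' G' Y' \<Psi>' T' \<and>
     epm_compact \<F>' (D_GENEO \<Phi>' Y') \<and>
     (\<exists>j\<^sub>1 i\<^sub>1 k\<^sub>1 j\<^sub>2 i\<^sub>2 k\<^sub>2 f.
        perception_pair_compactification X \<Phi> G X' \<Phi>' G' j\<^sub>1 i\<^sub>1 k\<^sub>1 \<and>
        perception_pair_compactification Y \<Psi> H Y' \<Psi>' H' j\<^sub>2 i\<^sub>2 k\<^sub>2 \<and>
        dense_isometric_embedding \<F> (D_GENEO \<Phi> Y) \<F>' (D_GENEO \<Phi>' Y') f \<and>
        (\<forall>F\<in>\<F>. \<forall>\<phi>\<in>\<Phi>. i\<^sub>2 (F \<phi>) = f F (i\<^sub>1 \<phi>)) \<and>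
        (\<forall>g\<in>G. k\<^sub>2 (T g) = T' (k\<^sub>1 g)))"

text \<open>
  HOL cannot quantify existentially over types, so the type of the points of a compactification has
  to be named. Functions \<open>X \<rightarrow> \<real>\<close> suffice: if \<open>D_pt \<Phi>\<close> is a metric on \<open>X\<close>, then
  \<open>x \<mapsto> D_pt \<Phi> x\<close> is the Kuratowski embedding of \<open>X\<close> into the bounded functions, and the
  closure of its image is a completion of \<open>X\<close>.
\<close>

definition admits_compactification ::
  "'x set \<Rightarrow> ('x \<Rightarrow> real) set \<Rightarrow> ('x \<Rightarrow> 'x) set \<Rightarrow>
   'y set \<Rightarrow> ('y \<Rightarrow> real) set \<Rightarrow> ('y \<Rightarrow> 'y) set \<Rightarrow>
   (('x \<Rightarrow> 'x) \<Rightarrow> ('y \<Rightarrow> 'y)) \<Rightarrow> (('x \<Rightarrow> real) \<Rightarrow> ('y \<Rightarrow> real)) set \<Rightarrow> bool" where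
  "admits_compactification X \<Phi> G Y \<Psi> H T \<F> \<longleftrightarrow>
     (\<exists>(X' :: ('x \<Rightarrow> real) set) \<Phi>' G' (Y' :: ('y \<Rightarrow> real) set) \<Psi>' H' T' \<F>'.
        geneo_space_compactification X \<Phi> G Y \<Psi> H T \<F> X' \<Phi>' G' Y' \<Psi>' H' T' \<F>')"

end

theory Submission
  imports Defs
begin

text \<open>
  Every distance involved is a uniform distance \<open>udist A d f g = (SUP a\<in>A. d (f a) (g a))\<close>: points
  of \<open>X\<close> are compared as evaluation maps on \<open>\<Phi>\<close>, data functions as maps \<open>X \<rightarrow> \<real>\<close>, group elements as
  maps \<open>X \<rightarrow> X\<close>, and operators as maps \<open>\<Phi> \<rightarrow> \<Psi>\<close>. Moreover all these maps are nonexpansive: data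
  functions by the definition of \<open>D_pt \<Phi>\<close>, group elements because \<open>\<phi> \<circ> g\<close> is again in \<open>\<Phi>\<close>, operators
  by assumption. A nonexpansive map extends uniquely to the completions, and the extension preserves
  uniform distances. Hence one construction, \<open>map_closure_is_completion\<close>, yields \<open>\<Phi>'\<close>, \<open>G'\<close> and \<open>\<F>'\<close>:
  extend all members of the given set to the completions of their domain and codomain, and close up
  under the uniform distance. The result is complete and contains the given set densely and
  isometrically. It starts from the Kuratowski completion \<open>X'\<close> of \<open>X\<close>, whose points are functions on
  \<open>X\<close>.

  Complete and totally bounded means compact. Total boundedness is inherited along the chain \<open>\<Phi>\<close>, \<open>X\<close>,
  \<open>G\<close> and \<open>\<F>\<close> by the Arzela--Ascoli argument \<open>totally_bdd_nonexp\<close>: nonexpansive maps from one totally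
  bounded space to another form a totally bounded set. It applies to evaluation maps from \<open>\<Phi>\<close> to a
  bounded interval, to maps from \<open>X\<close> to \<open>X\<close>, and to maps from \<open>\<Phi>\<close> to \<open>\<Psi>\<close>.

  The algebra passes to the closures by density. Composition is jointly continuous, so identities that
  hold on the dense images hold everywhere; inversion on \<open>G\<close> is nonexpansive and so extends to \<open>G'\<close>. The
  homomorphism \<open>T\<close> also has to extend, and this is what collectionwise surjectivity is for: every
  \<open>\<psi> \<in> \<Psi>\<close> has the form \<open>F \<phi>\<close>, so \<open>\<psi> \<circ> T g = F (\<phi> \<circ> g)\<close>, and nonexpansiveness of the operators \<open>F\<close>
  makes \<open>T\<close> nonexpansive.
\<close>

lemma less_add_ennreal:
  fixes x y :: ennreal
  assumes "x < ennreal a" "y < ennreal b" shows "x + y < ennreal (a + b)"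
proof -
  have pos: "a > 0" "b > 0" using assms by (auto intro: ccontr simp: ennreal_neg not_less)
  then have "x + y < ennreal a + ennreal b"
    using assms by (intro add_strict_mono)
  then show ?thesis using pos by simp
qed

section \<open>Extended pseudo-metrics: total boundedness and completeness\<close>

locale ext_pseudo_metric =
  fixes d :: "'a \<Rightarrow> 'a \<Rightarrow> ennreal"
  assumes refl: "d x x = 0" and sym: "d x y = d y x" and tri: "d x z \<le> d x y + d y z"
begin

lemma tri_less: "d x y < ennreal a \<Longrightarrow> d y z < ennreal b \<Longrightarrow> d x z < ennreal (a + b)"
  by (rule order_le_less_trans[OF tri less_add_ennreal])

lemma tri4: "d x w \<le> d x y + d y z + d z w"
  using tri[of x w z] tri[of x z y] by (meson add_right_mono order_trans)

text \<open>
  How an identity in a closure is proved below: both sides lie arbitrarily close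
  to a common third element.
\<close>

lemma eq_0I:
  assumes "\<And>e. e > 0 \<Longrightarrow> \<exists>w. d u w < ennreal e \<and> d v w < ennreal e"
  shows "d u v = 0"
proof -
  have "d u v \<le> 0"
  proof (rule ennreal_le_epsilon)
    fix e :: real assume e: "e > 0"
    then obtain w where "d u w < ennreal (e/2)" "d v w < ennreal (e/2)"
      using assms half_gt_zero by blast
    then have "d u v < ennreal (e/2 + e/2)" using sym by (metis tri_less)
    then show "d u v \<le> 0 + ennreal e" by simp
  qed
  then show ?thesis by simp
qed

end

definition separated :: "('a \<Rightarrow> 'a \<Rightarrow> ennreal) \<Rightarrow> 'a set \<Rightarrow> bool" where
  "separated d S \<longleftrightarrow> (\<forall>x\<in>S. \<forall>y\<in>S. d x y = 0 \<longrightarrow> x = y)"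

definition totally_bdd :: "('a \<Rightarrow> 'a \<Rightarrow> ennreal) \<Rightarrow> 'a set \<Rightarrow> bool" where
  "totally_bdd d S \<longleftrightarrow> (\<forall>e>0. \<exists>K. finite K \<and> K \<subseteq> S \<and> (\<forall>x\<in>S. \<exists>k\<in>K. d x k < ennreal e))"

definition complete_on :: "('a \<Rightarrow> 'a \<Rightarrow> ennreal) \<Rightarrow> 'a set \<Rightarrow> bool" where
  "complete_on d S \<longleftrightarrow>
     (\<forall>\<sigma>. (\<forall>n::nat. \<sigma> n \<in> S) \<longrightarrow> (\<forall>e>0. \<exists>N. \<forall>m\<ge>N. \<forall>n\<ge>N. d (\<sigma> m) (\<sigma> n) < ennreal e)
        \<longrightarrow> (\<exists>l\<in>S. \<forall>e>0. \<exists>N. \<forall>n\<ge>N. d (\<sigma> n) l < ennreal e))"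

lemma complete_onD:
  assumes "complete_on d S" "\<And>n::nat. \<sigma> n \<in> S"
    "\<And>e. e > 0 \<Longrightarrow> \<exists>N. \<forall>m\<ge>N. \<forall>n\<ge>N. d (\<sigma> m) (\<sigma> n) < ennreal e"
  obtains l where "l \<in> S" "\<And>e. e > 0 \<Longrightarrow> \<exists>N. \<forall>n\<ge>N. d (\<sigma> n) l < ennreal e"
  using assms unfolding complete_on_def by blast

text \<open>
  The truncated distance \<open>min 1 (d x y)\<close> is a real metric with the same topology and the same Cauchy
  sequences, for which compactness is known to be completeness plus total boundedness.
\<close>

lemma (in ext_pseudo_metric) epm_compactI:
  assumes sep: "separated d S" and comp: "complete_on d S" and tb: "totally_bdd d S"
  shows "epm_compact S d"
proof -
  define m where "m x y = enn2real (min 1 (d x y))" for x y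
  have m: "ennreal (m x y) = min 1 (d x y)" for x y
    unfolding m_def by (rule ennreal_enn2real) (auto simp: min_less_iff_disj)
  have m_nonneg: "0 \<le> m x y" for x y by (simp add: m_def)
  have m_less: "m x y < e \<longleftrightarrow> d x y < ennreal e" if "0 < e" "e \<le> 1" for x y e
  proof -
    have "m x y < e \<longleftrightarrow> ennreal (m x y) < ennreal e"
      using that by (auto simp: ennreal_less_iff m_def)
    also have "\<dots> \<longleftrightarrow> d x y < ennreal e"
      using that ennreal_leI[of e 1] unfolding m min_less_iff_disj by (auto simp: not_less)
    finally show ?thesis .
  qed
  interpret M: Metric_space S m
  proof
    show "0 \<le> m x y" "m x y = m y x" for x y by (auto simp: m_def sym)
    show "m x y = 0 \<longleftrightarrow> x = y" if "x \<in> S" "y \<in> S" for x y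
    proof
      assume "m x y = 0"
      then have "min 1 (d x y) = 0" using m[of x y] by simp
      then have "d x y = 0" by (auto simp: min_def split: if_splits)
      then show "x = y" using sep that by (auto simp: separated_def)
    qed (simp add: m_def refl)
    show "m x z \<le> m x y + m y z" for x y z
    proof -
      have "min 1 (d x z) \<le> min 1 (d x y) + min 1 (d y z)"
      proof (cases "d x y \<le> 1 \<and> d y z \<le> 1")
        case True
        then show ?thesis using tri[of x z y] by (auto simp: min_def)
      next
        case False
        then have "1 \<le> min 1 (d x y) + min 1 (d y z)"
          by (auto simp: min_def not_le add_increasing add_increasing2)
        then show ?thesis by (meson min.cobounded1 order_trans)
      qed
      then have "ennreal (m x z) \<le> ennreal (m x y + m y z)"
        by (simp add: m m_nonneg)
      then show ?thesis by (simp add: m_nonneg ennreal_le_iff add_nonneg_nonneg del: ennreal_plus)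
    qed
  qed
  have "openin (epm_topology S d) U \<longleftrightarrow> openin (epm_topology S (\<lambda>x y. ennreal (m x y))) U" for U
  proof -
    have "(\<exists>r>0. \<forall>y\<in>S. d x y < ennreal r \<longrightarrow> y \<in> U)
        \<longleftrightarrow> (\<exists>r>0. \<forall>y\<in>S. ennreal (m x y) < ennreal r \<longrightarrow> y \<in> U)" (is "?L \<longleftrightarrow> ?R") for x
    proof
      assume ?L
      then obtain r where "r > 0" "\<forall>y\<in>S. d x y < ennreal r \<longrightarrow> y \<in> U" by blast
      then show ?R
        using m_less[of "min r 1" x]
        by (intro exI[of _ "min r 1"]) (auto simp: ennreal_less_iff m_nonneg order_less_le_trans[OF _ ennreal_leI])
    next
      assume ?R
      then obtain r where r: "r > 0" "\<forall>y\<in>S. ennreal (m x y) < ennreal r \<longrightarrow> y \<in> U" by blast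
      have "d x y < ennreal r \<Longrightarrow> ennreal (m x y) < ennreal r" for y
        by (simp add: m min_less_iff_disj)
      then show ?L using r by blast
    qed
    then show ?thesis by (simp add: openin_epm_topology)
  qed
  then have top: "epm_topology S d = M.mtopology"
    using M.epm_topology_eq_mtopology by (simp add: topology_eq)
  have "M.mcomplete"
    unfolding M.mcomplete_def
  proof (intro allI impI)
    fix \<sigma> assume C: "M.MCauchy \<sigma>"
    have "\<exists>N. \<forall>i\<ge>N. \<forall>n\<ge>N. d (\<sigma> i) (\<sigma> n) < ennreal e" if "e > 0" for e
    proof -
      obtain N where "\<forall>i\<ge>N. \<forall>n\<ge>N. m (\<sigma> i) (\<sigma> n) < min e 1"
        using C \<open>e > 0\<close> unfolding M.MCauchy_def
        by (metis min_less_iff_conj zero_less_one)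
      then have "\<forall>i\<ge>N. \<forall>n\<ge>N. d (\<sigma> i) (\<sigma> n) < ennreal (min e 1)"
        using \<open>e > 0\<close> m_less[of "min e 1"] by (simp del: min_less_iff_conj)
      then show ?thesis by (meson ennreal_leI min.cobounded1 order_less_le_trans)
    qed
    moreover have "\<sigma> n \<in> S" for n using C by (auto simp: M.MCauchy_def)
    ultimately obtain l where l: "l \<in> S" "\<And>e. e > 0 \<Longrightarrow> \<exists>N. \<forall>n\<ge>N. d (\<sigma> n) l < ennreal e"
      using complete_onD[OF comp] by metis
    have "\<exists>N. \<forall>n\<ge>N. m (\<sigma> n) l < e" if "e > 0" for e
    proof -
      obtain N where "\<forall>n\<ge>N. d (\<sigma> n) l < ennreal (min e 1)"
        using l(2)[of "min e 1"] \<open>e > 0\<close> by auto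
      then have "\<forall>n\<ge>N. m (\<sigma> n) l < min e 1"
        using \<open>e > 0\<close> m_less[of "min e 1"] by (simp del: min_less_iff_conj)
      then show ?thesis by auto
    qed
    moreover have "range \<sigma> \<subseteq> S" using C by (simp add: M.MCauchy_def)
    ultimately have "limitin M.mtopology \<sigma> l sequentially"
      using l(1) by (simp add: M.limitin_metric eventually_sequentially image_subset_iff)
    then show "\<exists>x. limitin M.mtopology \<sigma> x sequentially" by blast
  qed
  moreover have "M.mtotally_bounded S"
    unfolding M.mtotally_bounded_def
  proof (intro allI impI)
    fix e :: real assume "e > 0"
    then obtain K where K: "finite K" "K \<subseteq> S" "\<forall>x\<in>S. \<exists>k\<in>K. d x k < ennreal (min e 1)"
      using tb unfolding totally_bdd_def by (metis min_less_iff_conj zero_less_one)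
    then have "\<forall>x\<in>S. \<exists>k\<in>K. m k x < min e 1"
      using \<open>e > 0\<close> sym by (metis m_less min.cobounded2 min_less_iff_conj zero_less_one)
    then show "\<exists>K. finite K \<and> K \<subseteq> S \<and> S \<subseteq> (\<Union>x\<in>K. M.mball x e)"
      using K by (intro exI[of _ K]) (auto simp: M.mball_def subset_eq)
  qed
  ultimately show ?thesis
    unfolding epm_compact_def top by (simp add: M.compact_space_eq_mcomplete_mtotally_bounded)
qed

text \<open>
  A colouring with finitely many colours gives a finite net, by choosing one element of each colour.
\<close>

lemma (in ext_pseudo_metric) totally_bddI_finite_colouring:
  assumes "\<And>e. e > 0 \<Longrightarrow> \<exists>c :: 'a \<Rightarrow> 'c. finite (c ` S) \<and> (\<forall>x\<in>S. \<forall>y\<in>S. c x = c y \<longrightarrow> d x y < ennreal e)"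
  shows "totally_bdd d S"
  unfolding totally_bdd_def
proof (intro allI impI)
  fix e :: real assume "e > 0"
  then obtain c :: "'a \<Rightarrow> 'c"
    where c: "finite (c ` S)" "\<forall>x\<in>S. \<forall>y\<in>S. c x = c y \<longrightarrow> d x y < ennreal e"
    using assms by blast
  show "\<exists>K. finite K \<and> K \<subseteq> S \<and> (\<forall>x\<in>S. \<exists>k\<in>K. d x k < ennreal e)"
  proof (intro exI conjI ballI)
    show "finite (inv_into S c ` c ` S)" using c by simp
    show "inv_into S c ` c ` S \<subseteq> S" by (auto intro: inv_into_into)
    show "\<exists>k\<in>inv_into S c ` c ` S. d x k < ennreal e" if "x \<in> S" for x
      using that c(2) by (intro bexI[of _ "inv_into S c (c x)"]) (auto simp: f_inv_into_f inv_into_into)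
  qed
qed

lemma totally_bdd_isometric_vimage:
  assumes "ext_pseudo_metric d'" and iso: "\<And>x y. x \<in> S \<Longrightarrow> y \<in> S \<Longrightarrow> d' (f x) (f y) = d x y"
    and tb: "totally_bdd d' (f ` S)"
  shows "totally_bdd d S"
  unfolding totally_bdd_def
proof (intro allI impI)
  fix e :: real assume "e > 0"
  then obtain K where K: "finite K" "K \<subseteq> f ` S" "\<forall>x\<in>S. \<exists>k\<in>K. d' (f x) k < ennreal e"
    using tb unfolding totally_bdd_def by (metis imageI)
  obtain L where L: "L \<subseteq> S" "finite L" "K = f ` L" using K finite_subset_image by metis
  show "\<exists>K. finite K \<and> K \<subseteq> S \<and> (\<forall>x\<in>S. \<exists>k\<in>K. d x k < ennreal e)"
    using K L iso by (intro exI[of _ L]) (auto, metis subsetD)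
qed

section \<open>Uniform distance and nonexpansive maps\<close>

definition udist :: "'a set \<Rightarrow> ('b \<Rightarrow> 'b \<Rightarrow> ennreal) \<Rightarrow> ('a \<Rightarrow> 'b) \<Rightarrow> ('a \<Rightarrow> 'b) \<Rightarrow> ennreal" where
  "udist A d f g = (SUP a\<in>A. d (f a) (g a))"

lemma udist_upper: "a \<in> A \<Longrightarrow> d (f a) (g a) \<le> udist A d f g"
  unfolding udist_def by (rule SUP_upper)

lemma udist_least: "(\<And>a. a \<in> A \<Longrightarrow> d (f a) (g a) \<le> c) \<Longrightarrow> udist A d f g \<le> c"
  unfolding udist_def by (rule SUP_least)

lemma udist_less:
  assumes "0 < e" "e < e'" "\<And>a. a \<in> A \<Longrightarrow> d (f a) (g a) < ennreal e"
  shows "udist A d f g < ennreal e'"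
proof -
  have "udist A d f g \<le> ennreal e" using assms(3) by (intro udist_least) (rule less_imp_le)
  also have "\<dots> < ennreal e'" using assms(1,2) by (simp add: ennreal_less_iff)
  finally show ?thesis .
qed

lemma udist_lessD: "udist A d f g < e \<Longrightarrow> a \<in> A \<Longrightarrow> d (f a) (g a) < e"
  by (meson udist_upper order_le_less_trans)

lemma udist_cong:
  assumes "\<And>a. a \<in> A \<Longrightarrow> d (f a) (g a) = d' (f' a) (g' a)"
  shows "udist A d f g = udist A d' f' g'"
  unfolding udist_def using assms by (intro SUP_cong) auto

lemma ext_pseudo_metric_udist:
  assumes "ext_pseudo_metric d" shows "ext_pseudo_metric (udist A d)"
proof -
  interpret ext_pseudo_metric d by fact
  show ?thesis
  proof
    show "udist A d f f = 0" for f by (simp add: udist_def refl bot_ennreal[symmetric] del: bot_ennreal)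
    show "udist A d f g = udist A d g f" for f g unfolding udist_def by (simp add: sym)
    show "udist A d f h \<le> udist A d f g + udist A d g h" for f g h
    proof (rule udist_least)
      fix a assume a: "a \<in> A"
      show "d (f a) (h a) \<le> udist A d f g + udist A d g h"
        using tri[of "f a" "h a" "g a"] udist_upper[OF a, of d f g] udist_upper[OF a, of d g h]
        by (meson add_mono order_trans)
    qed
  qed
qed

definition nonexp ::
  "'a set \<Rightarrow> ('a \<Rightarrow> 'a \<Rightarrow> ennreal) \<Rightarrow> 'b set \<Rightarrow> ('b \<Rightarrow> 'b \<Rightarrow> ennreal) \<Rightarrow> ('a \<Rightarrow> 'b) set" where
  "nonexp A d B d' = {f \<in> A \<rightarrow> B. \<forall>x\<in>A. \<forall>y\<in>A. d' (f x) (f y) \<le> d x y}"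

lemma nonexpI:
  "(\<And>x. x \<in> A \<Longrightarrow> f x \<in> B) \<Longrightarrow> (\<And>x y. x \<in> A \<Longrightarrow> y \<in> A \<Longrightarrow> d' (f x) (f y) \<le> d x y) \<Longrightarrow>
    f \<in> nonexp A d B d'"
  by (auto simp: nonexp_def)

lemma nonexp_mem: "f \<in> nonexp A d B d' \<Longrightarrow> x \<in> A \<Longrightarrow> f x \<in> B"
  by (auto simp: nonexp_def)

lemma nonexp_le: "f \<in> nonexp A d B d' \<Longrightarrow> x \<in> A \<Longrightarrow> y \<in> A \<Longrightarrow> d' (f x) (f y) \<le> d x y"
  by (auto simp: nonexp_def)

lemma nonexp_less:
  "f \<in> nonexp A d B d' \<Longrightarrow> x \<in> A \<Longrightarrow> y \<in> A \<Longrightarrow> d x y < e \<Longrightarrow> d' (f x) (f y) < e"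
  by (meson nonexp_le order_le_less_trans)

text \<open>
  The Arzela--Ascoli argument: up to an error, a nonexpansive map is determined by the points of a
  finite net of \<open>B\<close> nearest to its values on a finite net of \<open>A\<close>.
\<close>

lemma totally_bdd_nonexp:
  assumes d: "ext_pseudo_metric d" "totally_bdd d A"
    and d': "ext_pseudo_metric d'" "totally_bdd d' B"
    and F: "F \<subseteq> nonexp A d B d'"
  shows "totally_bdd (udist A d') F"
proof -
  interpret D: ext_pseudo_metric d by fact
  interpret D': ext_pseudo_metric d' by fact
  interpret U: ext_pseudo_metric "udist A d'" by (rule ext_pseudo_metric_udist) fact
  show ?thesis
  proof (rule U.totally_bddI_finite_colouring)
    fix e :: real assume "e > 0"
    \<comment> \<open>The path from \<open>f a\<close> to \<open>g a\<close> through \<open>f k\<close>, \<open>p (f k) = p (g k)\<close> and \<open>g k\<close> has four steps; the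
      fifth part of \<open>e\<close> leaves room for the supremum.\<close>
    obtain K where K: "finite K" "K \<subseteq> A" "\<forall>x\<in>A. \<exists>k\<in>K. d x k < ennreal (e/5)"
      using d(2) \<open>e > 0\<close> unfolding totally_bdd_def by (metis zero_less_divide_iff zero_less_numeral)
    obtain L where L: "finite L" "L \<subseteq> B" "\<forall>x\<in>B. \<exists>k\<in>L. d' x k < ennreal (e/5)"
      using d'(2) \<open>e > 0\<close> unfolding totally_bdd_def by (metis zero_less_divide_iff zero_less_numeral)
    obtain p where p: "\<And>x. x \<in> B \<Longrightarrow> p x \<in> L \<and> d' x (p x) < ennreal (e/5)" using L(3) by metis
    define c where "c f = (\<lambda>k\<in>K. p (f k))" for f
    show "\<exists>c :: ('a \<Rightarrow> 'b) \<Rightarrow> ('a \<Rightarrow> 'b). finite (c ` F) \<and>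
      (\<forall>f\<in>F. \<forall>g\<in>F. c f = c g \<longrightarrow> udist A d' f g < ennreal e)"
    proof (intro exI[of _ c] conjI ballI impI)
      have "c f \<in> K \<rightarrow>\<^sub>E L" if "f \<in> F" for f
        using nonexp_mem[of f A d B d'] that F K(2) p by (auto simp: c_def)
      then have "c ` F \<subseteq> K \<rightarrow>\<^sub>E L" by blast
      then show "finite (c ` F)" using K L by (meson finite_PiE finite_subset)
      fix f g assume f: "f \<in> F" and g: "g \<in> F" and cfg: "c f = c g"
      show "udist A d' f g < ennreal e"
      proof (rule udist_less)
        have f: "f \<in> nonexp A d B d'" and g: "g \<in> nonexp A d B d'" using f g F by auto
        show "0 < 4*e/5" "4*e/5 < e" using \<open>e > 0\<close> by auto
        fix a assume a: "a \<in> A"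
        obtain k where k: "k \<in> K" "d a k < ennreal (e/5)" using K a by blast
        have "p (f k) = p (g k)" using fun_cong[OF cfg, of k] k by (simp add: c_def)
        moreover have "f k \<in> B" "g k \<in> B" using nonexp_mem[OF f] nonexp_mem[OF g] k K by auto
        ultimately have 1: "d' (f k) (p (f k)) < ennreal (e/5)" "d' (p (f k)) (g k) < ennreal (e/5)"
          using p D'.sym by metis+
        have "d k a < ennreal (e/5)" using k D.sym by metis
        then have 2: "d' (f a) (f k) < ennreal (e/5)" "d' (g k) (g a) < ennreal (e/5)"
          using k K a nonexp_less[OF f] nonexp_less[OF g] by blast+
        have "d' (f a) (g a) < ennreal (e/5 + e/5 + e/5 + e/5)"
          by (rule D'.tri_less[OF D'.tri_less[OF D'.tri_less[OF 2(1) 1(1)] 1(2)] 2(2)])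
        then show "d' (f a) (g a) < ennreal (4*e/5)" by simp
      qed
    qed
  qed
qed

lemma complete_on_closed_subset:
  assumes "complete_on d S" "T \<subseteq> S" "ext_pseudo_metric d"
    and closed: "\<And>y. y \<in> S \<Longrightarrow> (\<And>e. e > 0 \<Longrightarrow> \<exists>t\<in>T. d y t < ennreal e) \<Longrightarrow> y \<in> T"
  shows "complete_on d T"
  unfolding complete_on_def
proof (intro allI impI)
  interpret ext_pseudo_metric d by fact
  fix \<sigma> :: "nat \<Rightarrow> 'a"
  assume T: "\<forall>n. \<sigma> n \<in> T" and C: "\<forall>e>0. \<exists>N. \<forall>m\<ge>N. \<forall>n\<ge>N. d (\<sigma> m) (\<sigma> n) < ennreal e"
  obtain l where l: "l \<in> S" "\<And>e. e > 0 \<Longrightarrow> \<exists>N. \<forall>n\<ge>N. d (\<sigma> n) l < ennreal e"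
    by (rule complete_onD[OF assms(1), of \<sigma>]) (use T C assms(2) in auto)
  have "l \<in> T"
  proof (rule closed[OF l(1)])
    fix e :: real assume "e > 0"
    then obtain N where "d (\<sigma> N) l < ennreal e" using l(2) by blast
    then show "\<exists>t\<in>T. d l t < ennreal e" using T sym by metis
  qed
  then show "\<exists>l\<in>T. \<forall>e>0. \<exists>N. \<forall>n\<ge>N. d (\<sigma> n) l < ennreal e" using l by blast
qed

text \<open>
  A uniform Cauchy sequence converges pointwise, and the Cauchy bound passes to the limit uniformly.
\<close>

lemma complete_on_udist:
  assumes "ext_pseudo_metric d" and comp: "complete_on d B"
  shows "complete_on (udist A d) (A \<rightarrow>\<^sub>E B)"
  unfolding complete_on_def
proof (intro allI impI)
  interpret ext_pseudo_metric d by fact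
  fix \<sigma> :: "nat \<Rightarrow> 'b \<Rightarrow> 'a"
  assume mem: "\<forall>n. \<sigma> n \<in> A \<rightarrow>\<^sub>E B"
    and C: "\<forall>e>0. \<exists>N. \<forall>m\<ge>N. \<forall>n\<ge>N. udist A d (\<sigma> m) (\<sigma> n) < ennreal e"
  have "\<exists>l\<in>B. \<forall>e>0. \<exists>N. \<forall>n\<ge>N. d (\<sigma> n a) l < ennreal e" if a: "a \<in> A" for a
  proof (rule complete_onD[OF comp, of "\<lambda>n. \<sigma> n a"])
    show "\<sigma> n a \<in> B" for n using mem a by auto
    show "\<exists>N. \<forall>m\<ge>N. \<forall>n\<ge>N. d (\<sigma> m a) (\<sigma> n a) < ennreal e" if "e > 0" for e
      using C that udist_lessD[OF _ a, of d] by meson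
  qed blast
  then obtain l where l: "\<And>a. a \<in> A \<Longrightarrow> l a \<in> B"
    "\<And>a e. a \<in> A \<Longrightarrow> e > 0 \<Longrightarrow> \<exists>N. \<forall>n\<ge>N. d (\<sigma> n a) (l a) < ennreal e"
    by metis
  show "\<exists>l\<in>A \<rightarrow>\<^sub>E B. \<forall>e>0. \<exists>N. \<forall>n\<ge>N. udist A d (\<sigma> n) l < ennreal e"
  proof (intro bexI[of _ "restrict l A"] allI impI)
    fix e :: real assume "e > 0"
    then obtain N where N: "\<And>m n. m \<ge> N \<Longrightarrow> n \<ge> N \<Longrightarrow> udist A d (\<sigma> m) (\<sigma> n) < ennreal (e/4)"
      using C by (meson zero_less_divide_iff zero_less_numeral)
    have "udist A d (\<sigma> n) (restrict l A) < ennreal e" if n: "n \<ge> N" for n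
    proof (rule udist_less)
      show "0 < e/2" "e/2 < e" using \<open>e > 0\<close> by auto
      fix a assume a: "a \<in> A"
      \<comment> \<open>The index \<open>M\<close> depends on \<open>a\<close>, but it does not enter the final bound.\<close>
      obtain M where M: "\<And>m. m \<ge> M \<Longrightarrow> d (\<sigma> m a) (l a) < ennreal (e/4)"
        using l(2)[OF a, of "e/4"] \<open>e > 0\<close> by auto
      have "d (\<sigma> n a) (\<sigma> (max M N) a) < ennreal (e/4)"
        using N[OF n, of "max M N"] udist_lessD[OF _ a] by simp
      then have "d (\<sigma> n a) (l a) < ennreal (e/4 + e/4)"
        using M[of "max M N"] by (intro tri_less) auto
      then show "d (\<sigma> n a) (restrict l A a) < ennreal (e/2)" using a by simp
    qed
    then show "\<exists>N. \<forall>n\<ge>N. udist A d (\<sigma> n) (restrict l A) < ennreal e" by blast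
  qed (use l in auto)
qed

lemma separated_udist:
  assumes "separated d B" shows "separated (udist A d) (A \<rightarrow>\<^sub>E B)"
  unfolding separated_def
proof (intro ballI impI)
  fix f g assume fg: "f \<in> A \<rightarrow>\<^sub>E B" "g \<in> A \<rightarrow>\<^sub>E B" and 0: "udist A d f g = 0"
  have "f a = g a" if "a \<in> A" for a
  proof -
    have "d (f a) (g a) = 0" using udist_upper[OF that, of d f g] 0 by simp
    then show ?thesis using assms fg that by (auto simp: separated_def PiE_iff)
  qed
  then show "f = g" using fg by (metis PiE_ext)
qed

lemma separated_subset: "separated d S \<Longrightarrow> T \<subseteq> S \<Longrightarrow> separated d T"
  by (auto simp: separated_def)

section \<open>Completions and extension of nonexpansive maps\<close>

text \<open>
  The completion is not required to be of a particular form, so that the same notion covers \<open>X\<close>, \<open>\<Phi>\<close>,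
  \<open>G\<close>, the space of operators, and \<open>\<real>\<close> as its own completion. If \<open>d\<close> is only a
  pseudo-metric on \<open>A\<close>, then \<open>j\<close> identifies points at distance \<open>0\<close>.
\<close>

definition is_completion ::
  "'a set \<Rightarrow> ('a \<Rightarrow> 'a \<Rightarrow> ennreal) \<Rightarrow> 'b set \<Rightarrow> ('b \<Rightarrow> 'b \<Rightarrow> ennreal) \<Rightarrow> ('a \<Rightarrow> 'b) \<Rightarrow> bool" where
  "is_completion A d A' d' j \<longleftrightarrow>
     j \<in> A \<rightarrow> A' \<and> (\<forall>x\<in>A. \<forall>y\<in>A. d' (j x) (j y) = d x y) \<and>
     (\<forall>y\<in>A'. \<forall>e>0. \<exists>x\<in>A. d' y (j x) < ennreal e) \<and>
     complete_on d' A' \<and> separated d' A'"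

lemma is_completionD:
  assumes "is_completion A d A' d' j"
  shows "\<And>x. x \<in> A \<Longrightarrow> j x \<in> A'"
    and "\<And>x y. x \<in> A \<Longrightarrow> y \<in> A \<Longrightarrow> d' (j x) (j y) = d x y"
    and "\<And>y e. y \<in> A' \<Longrightarrow> e > 0 \<Longrightarrow> \<exists>x\<in>A. d' y (j x) < ennreal e"
    and "complete_on d' A'" and "separated d' A'"
  using assms by (auto simp: is_completion_def)

lemma is_completion_approx:
  assumes "is_completion A d A' d' j" "y \<in> A'" "e > 0"
  obtains x where "x \<in> A" "d' y (j x) < ennreal e"
  using is_completionD(3)[OF assms] by blast

lemma is_completion_cong:
  assumes "is_completion A d A' d' j"
    and "\<And>x y. x \<in> A \<Longrightarrow> y \<in> A \<Longrightarrow> d x y = c x y"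
    and "\<And>x y. x \<in> A' \<Longrightarrow> y \<in> A' \<Longrightarrow> d' x y = c' x y"
  shows "is_completion A c A' c' j"
proof -
  note D = is_completionD[OF assms(1)]
  have "complete_on c' A'"
    unfolding complete_on_def
  proof (intro allI impI)
    fix \<sigma> :: "nat \<Rightarrow> 'b"
    assume s: "\<forall>n. \<sigma> n \<in> A'" and C: "\<forall>e>0. \<exists>N. \<forall>m\<ge>N. \<forall>n\<ge>N. c' (\<sigma> m) (\<sigma> n) < ennreal e"
    obtain l where "l \<in> A'" "\<And>e. e > 0 \<Longrightarrow> \<exists>N. \<forall>n\<ge>N. d' (\<sigma> n) l < ennreal e"
      by (rule complete_onD[OF D(4), of \<sigma>]) (use s C assms(3) in auto)
    then show "\<exists>l\<in>A'. \<forall>e>0. \<exists>N. \<forall>n\<ge>N. c' (\<sigma> n) l < ennreal e" using s assms(3) by auto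
  qed
  then show ?thesis
    using D assms(2,3) unfolding is_completion_def separated_def by (simp add: Pi_iff)
qed

lemma epm_topology_cong:
  assumes "\<And>x y. x \<in> S \<Longrightarrow> y \<in> S \<Longrightarrow> d x y = d' x y"
  shows "epm_topology S d = epm_topology S d'"
  unfolding topology_eq openin_epm_topology using assms by (metis (no_types, lifting) subsetD)

lemma closure_of_epm_topologyI:
  assumes "T \<subseteq> S" "\<And>y e. y \<in> S \<Longrightarrow> e > 0 \<Longrightarrow> \<exists>x\<in>T. d y x < ennreal e"
  shows "epm_topology S d closure_of T = S"
proof
  show "epm_topology S d closure_of T \<subseteq> S"
    using closure_of_subset_topspace[of "epm_topology S d" T] by simp
  show "S \<subseteq> epm_topology S d closure_of T"
    using assms unfolding closure_of_def openin_epm_topology topspace_epm_topology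
    by (auto, meson subsetD)
qed

lemma is_completion_imp_dense_isometric_embedding:
  assumes c: "is_completion A d A' d' j" and "separated d A" "ext_pseudo_metric d'"
  shows "dense_isometric_embedding A d A' d' j"
  unfolding dense_isometric_embedding_def
proof (intro conjI)
  interpret ext_pseudo_metric d' by fact
  note D = is_completionD[OF c]
  show "j \<in> A \<rightarrow> A'" using D by blast
  show "inj_on j A" using assms(2) D(2) refl unfolding inj_on_def separated_def by metis
  show "\<forall>x\<in>A. \<forall>y\<in>A. d' (j x) (j y) = d x y" using D by blast
  show "epm_topology A' d' closure_of j ` A = A'"
    using D(1,3) by (intro closure_of_epm_topologyI) auto
qed

lemma is_completion_imp_epm_compact:
  assumes c: "is_completion A d A' d' j" and tb: "totally_bdd d A" and d': "ext_pseudo_metric d'"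
  shows "epm_compact A' d'" "totally_bdd d' A'"
proof -
  interpret ext_pseudo_metric d' by fact
  note D = is_completionD[OF c]
  show "totally_bdd d' A'"
    unfolding totally_bdd_def
  proof (intro allI impI)
    fix e :: real assume "e > 0"
    then obtain K where K: "finite K" "K \<subseteq> A" "\<forall>x\<in>A. \<exists>k\<in>K. d x k < ennreal (e/2)"
      using tb unfolding totally_bdd_def by (metis half_gt_zero)
    have "\<exists>k\<in>K. d' y (j k) < ennreal e" if y: "y \<in> A'" for y
    proof -
      obtain x where x: "x \<in> A" "d' y (j x) < ennreal (e/2)"
        by (rule is_completion_approx[OF c y, of "e/2"]) (use \<open>e > 0\<close> in auto)
      obtain k where k: "k \<in> K" "d x k < ennreal (e/2)" using K x by blast
      have "d' (j x) (j k) < ennreal (e/2)" using D(2)[of x k] x k K by auto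
      then have "d' y (j k) < ennreal (e/2 + e/2)" by (rule tri_less[OF x(2)])
      then show ?thesis using k by auto
    qed
    then show "\<exists>K. finite K \<and> K \<subseteq> A' \<and> (\<forall>x\<in>A'. \<exists>k\<in>K. d' x k < ennreal e)"
      using K D(1) by (intro exI[of _ "j ` K"]) auto
  qed
  then show "epm_compact A' d'" using D by (intro epm_compactI) auto
qed

text \<open>
  The value at \<open>y\<close> is the limit of \<open>f\<close> along any sequence of \<open>A\<close> approaching \<open>y\<close>. All that is
  needed about it is the estimate \<open>dB (h y) (f x) \<le> dA' y (j x)\<close>, which yields both the extension
  property and nonexpansiveness.
\<close>

lemma nonexp_extends_to_completion:
  assumes dA': "ext_pseudo_metric dA'" and dB: "ext_pseudo_metric dB"
    and c: "is_completion A dA A' dA' j" and B: "complete_on dB B" "separated dB B"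
    and f: "f \<in> nonexp A dA B dB"
  obtains h where "h \<in> nonexp A' dA' B dB" "h \<in> A' \<rightarrow>\<^sub>E B" "\<And>x. x \<in> A \<Longrightarrow> h (j x) = f x"
proof -
  interpret A: ext_pseudo_metric dA' by fact
  interpret B: ext_pseudo_metric dB by fact
  note D = is_completionD[OF c]
  have "\<exists>b\<in>B. \<forall>x\<in>A. dB b (f x) \<le> dA' y (j x)" if y: "y \<in> A'" for y
  proof -
    have "\<forall>n::nat. \<exists>x. x \<in> A \<and> dA' y (j x) < ennreal (inverse (Suc n))"
      using D(3)[OF y] by (meson inverse_positive_iff_positive of_nat_0_less_iff zero_less_Suc)
    then obtain x where x: "\<And>n. x n \<in> A" "\<And>n::nat. dA' y (j (x n)) < ennreal (inverse (Suc n))"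
      by metis
    have small: "\<exists>N. \<forall>n\<ge>N. dA' y (j (x n)) < ennreal e" if e: "e > 0" for e
    proof -
      obtain N where "inverse (real (Suc N)) < e" using reals_Archimedean[OF e] by blast
      then have "inverse (real (Suc n)) \<le> e" if "n \<ge> N" for n
        using that by (smt (verit) inverse_le_imp_le le_imp_inverse_le of_nat_0_less_iff of_nat_mono Suc_le_mono zero_less_Suc)
      then show ?thesis using x(2) by (meson ennreal_leI order_less_le_trans)
    qed
    obtain b where b: "b \<in> B" "\<And>e. e > 0 \<Longrightarrow> \<exists>N. \<forall>n\<ge>N. dB (f (x n)) b < ennreal e"
    proof (rule complete_onD[OF B(1), of "\<lambda>n. f (x n)"])
      show "f (x n) \<in> B" for n using nonexp_mem[OF f x(1)] .
      fix e :: real assume "e > 0"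
      then obtain N where N: "\<And>n. n \<ge> N \<Longrightarrow> dA' y (j (x n)) < ennreal (e/2)"
        using small[of "e/2"] by auto
      have "dB (f (x m)) (f (x n)) < ennreal e" if "m \<ge> N" "n \<ge> N" for m n
      proof -
        have "dA' (j (x m)) (j (x n)) < ennreal (e/2 + e/2)"
          using N that A.sym by (intro A.tri_less[of _ y]) metis+
        then show ?thesis using nonexp_less[OF f x(1) x(1)] D(2)[OF x(1) x(1)] by simp
      qed
      then show "\<exists>N. \<forall>m\<ge>N. \<forall>n\<ge>N. dB (f (x m)) (f (x n)) < ennreal e" by blast
    qed (rule that)
    have "dB b (f z) \<le> dA' y (j z)" if z: "z \<in> A" for z
    proof (rule ennreal_le_epsilon)
      fix e :: real assume e: "e > 0"
      obtain N M where N: "\<And>n. n \<ge> N \<Longrightarrow> dA' y (j (x n)) < ennreal (e/2)"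
        and M: "\<And>n. n \<ge> M \<Longrightarrow> dB (f (x n)) b < ennreal (e/2)"
        using small[of "e/2"] b(2)[of "e/2"] e by auto
      define n where "n = max M N"
      have "dB b (f z) \<le> dB b (f (x n)) + dB (f (x n)) (f z)" by (rule B.tri)
      also have "dB (f (x n)) (f z) \<le> dA' (j (x n)) (j z)"
        using nonexp_le[OF f x(1) z] D(2)[OF x(1) z] by simp
      also have "dA' (j (x n)) (j z) \<le> dA' (j (x n)) y + dA' y (j z)" by (rule A.tri)
      also have "dB b (f (x n)) \<le> ennreal (e/2)"
        using M[of n] B.sym[of b] by (simp add: n_def less_imp_le)
      also have "dA' (j (x n)) y \<le> ennreal (e/2)"
        using N[of n] A.sym[of y] by (simp add: n_def less_imp_le)
      finally have "dB b (f z) \<le> ennreal (e/2) + (ennreal (e/2) + dA' y (j z))"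
        by (simp add: add_mono)
      also have "\<dots> = dA' y (j z) + (ennreal (e/2) + ennreal (e/2))" by (simp add: ac_simps)
      also have "ennreal (e/2) + ennreal (e/2) = ennreal e"
        using e by (simp flip: ennreal_plus)
      finally show "dB b (f z) \<le> dA' y (j z) + ennreal e" .
    qed
    then show ?thesis using b(1) by blast
  qed
  then obtain h where h: "\<And>y. y \<in> A' \<Longrightarrow> h y \<in> B"
    "\<And>y x. y \<in> A' \<Longrightarrow> x \<in> A \<Longrightarrow> dB (h y) (f x) \<le> dA' y (j x)"
    by metis
  show thesis
  proof (rule that[of "restrict h A'"])
    show "restrict h A' \<in> A' \<rightarrow>\<^sub>E B" using h(1) by auto
    show "restrict h A' \<in> nonexp A' dA' B dB"
    proof (rule nonexpI)
      fix y z assume y: "y \<in> A'" and z: "z \<in> A'"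
      have "dB (h y) (h z) \<le> dA' y z"
      proof (rule ennreal_le_epsilon)
        fix e :: real assume e: "e > 0"
        obtain x where x: "x \<in> A" "dA' y (j x) < ennreal (e/2)"
          by (rule is_completion_approx[OF c y, of "e/2"]) (use e in auto)
        have "dB (h y) (h z) \<le> dB (h y) (f x) + dB (f x) (h z)" by (rule B.tri)
        also have "\<dots> \<le> dA' y (j x) + (dA' z y + dA' y (j x))"
          using h(2)[OF y x(1)] h(2)[OF z x(1)] A.tri[of z "j x" y] B.sym[of "f x"]
          by (intro add_mono) auto
        also have "\<dots> \<le> ennreal (e/2) + (dA' z y + ennreal (e/2))"
          using x(2) by (intro add_mono) auto
        also have "\<dots> = dA' y z + (ennreal (e/2) + ennreal (e/2))"
          using A.sym[of z y] by (simp add: ac_simps)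
        also have "ennreal (e/2) + ennreal (e/2) = ennreal e"
          using e by (simp flip: ennreal_plus)
        finally show "dB (h y) (h z) \<le> dA' y z + ennreal e" .
      qed
      then show "dB (restrict h A' y) (restrict h A' z) \<le> dA' y z" using y z by simp
    qed (use h(1) in auto)
    show "restrict h A' (j x) = f x" if x: "x \<in> A" for x
    proof -
      have "dB (h (j x)) (f x) = 0" using h(2)[OF D(1)[OF x] x] A.refl by simp
      then show ?thesis
        using B(2) h(1)[OF D(1)[OF x]] nonexp_mem[OF f x] D(1)[OF x] by (simp add: separated_def)
    qed
  qed
qed

lemma udist_nonexp_dense:
  assumes "ext_pseudo_metric dA'" and dB: "ext_pseudo_metric dB"
    and c: "is_completion A dA A' dA' j"
    and f: "f \<in> nonexp A' dA' B dB" and g: "g \<in> nonexp A' dA' B dB"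
  shows "udist A' dB f g = udist A dB (\<lambda>x. f (j x)) (\<lambda>x. g (j x))"
proof (rule antisym)
  interpret B: ext_pseudo_metric dB by fact
  interpret A: ext_pseudo_metric dA' by fact
  note D = is_completionD[OF c]
  show "udist A dB (\<lambda>x. f (j x)) (\<lambda>x. g (j x)) \<le> udist A' dB f g"
    using D(1) by (intro udist_least udist_upper)
  show "udist A' dB f g \<le> udist A dB (\<lambda>x. f (j x)) (\<lambda>x. g (j x))" (is "_ \<le> ?R")
  proof (rule udist_least, rule ennreal_le_epsilon)
    fix y and e :: real assume y: "y \<in> A'" and e: "e > 0"
    obtain x where x: "x \<in> A" "dA' y (j x) < ennreal (e/2)"
      by (rule is_completion_approx[OF c y, of "e/2"]) (use e in auto)
    have "dB (f y) (g y) \<le> dB (f y) (f (j x)) + dB (f (j x)) (g (j x)) + dB (g (j x)) (g y)"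
      by (rule B.tri4)
    also have "\<dots> \<le> dA' y (j x) + ?R + dA' (j x) y"
      using nonexp_le[OF f y D(1)] nonexp_le[OF g D(1) y] x(1)
      by (intro add_mono udist_upper[of x A dB "\<lambda>x. f (j x)" "\<lambda>x. g (j x)"]) auto
    also have "\<dots> \<le> ennreal (e/2) + ?R + ennreal (e/2)"
      using x(2) A.sym[of y] by (intro add_mono) auto
    also have "\<dots> = ?R + (ennreal (e/2) + ennreal (e/2))" by (simp add: ac_simps)
    also have "ennreal (e/2) + ennreal (e/2) = ennreal e"
      using e by (simp flip: ennreal_plus)
    finally show "dB (f y) (g y) \<le> ?R + ennreal e" .
  qed
qed

lemma nonexp_eq_on_dense:
  assumes "ext_pseudo_metric dA'" "ext_pseudo_metric dB" "separated dB B"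
    and c: "is_completion A dA A' dA' j"
    and f: "f \<in> nonexp A' dA' B dB" "f \<in> extensional A'"
    and g: "g \<in> nonexp A' dA' B dB" "g \<in> extensional A'"
    and eq: "\<And>x. x \<in> A \<Longrightarrow> f (j x) = g (j x)"
  shows "f = g"
proof -
  interpret U: ext_pseudo_metric "udist A dB" by (rule ext_pseudo_metric_udist) fact
  have "udist A dB (\<lambda>x. f (j x)) (\<lambda>x. g (j x)) = udist A dB (\<lambda>x. f (j x)) (\<lambda>x. f (j x))"
    using eq by (intro udist_cong) auto
  then have "udist A' dB f g = 0"
    using udist_nonexp_dense[OF assms(1,2) c f(1) g(1)] U.refl by simp
  moreover have "f \<in> A' \<rightarrow>\<^sub>E B" "g \<in> A' \<rightarrow>\<^sub>E B" using f g by (auto simp: PiE_def nonexp_mem)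
  ultimately show ?thesis using separated_udist[OF assms(3), of A'] by (simp add: separated_def)
qed

section \<open>Completing a set of nonexpansive maps\<close>

text \<open>
  The uniform closure of the extensions of the maps \<open>b \<circ> f\<close>, described without choosing the extensions:
  a nonexpansive map on \<open>A'\<close> is determined by its restriction to the dense image of \<open>A\<close>.
\<close>

definition map_closure ::
  "'a set \<Rightarrow> 'c set \<Rightarrow> ('c \<Rightarrow> 'c \<Rightarrow> ennreal) \<Rightarrow> ('a \<Rightarrow> 'c) \<Rightarrow> 'e set \<Rightarrow> ('e \<Rightarrow> 'e \<Rightarrow> ennreal) \<Rightarrow> ('b \<Rightarrow> 'e)
     \<Rightarrow> ('a \<Rightarrow> 'b) set \<Rightarrow> ('c \<Rightarrow> 'e) set" where
  "map_closure A A' dA' j B' dB' b F = {h \<in> A' \<rightarrow>\<^sub>E B'. h \<in> nonexp A' dA' B' dB' \<and>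
     (\<forall>e>0. \<exists>f\<in>F. udist A dB' (\<lambda>x. h (j x)) (\<lambda>x. b (f x)) < ennreal e)}"

lemma map_closureI:
  assumes "h \<in> extensional A'" "h \<in> nonexp A' dA' B' dB'"
    "\<And>e. e > 0 \<Longrightarrow> \<exists>f\<in>F. udist A dB' (\<lambda>x. h (j x)) (\<lambda>x. b (f x)) < ennreal e"
  shows "h \<in> map_closure A A' dA' j B' dB' b F"
  using assms by (auto simp: map_closure_def PiE_def nonexp_mem)

lemma map_closureD:
  assumes "h \<in> map_closure A A' dA' j B' dB' b F"
  shows "h \<in> A' \<rightarrow>\<^sub>E B'" "h \<in> nonexp A' dA' B' dB'"
    "\<And>e. e > 0 \<Longrightarrow> \<exists>f\<in>F. udist A dB' (\<lambda>x. h (j x)) (\<lambda>x. b (f x)) < ennreal e"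
  using assms by (auto simp: map_closure_def)

lemma complete_on_map_closure:
  assumes dA': "ext_pseudo_metric dA'" and dB': "ext_pseudo_metric dB'" and B': "complete_on dB' B'"
    and j: "j \<in> A \<rightarrow> A'"
  shows "complete_on (udist A' dB') (map_closure A A' dA' j B' dB' b F)"
proof (rule complete_on_closed_subset[OF complete_on_udist[OF dB' B']])
  interpret B: ext_pseudo_metric dB' by fact
  interpret U: ext_pseudo_metric "udist A' dB'" by (rule ext_pseudo_metric_udist) fact
  interpret V: ext_pseudo_metric "udist A dB'" by (rule ext_pseudo_metric_udist) fact
  show "ext_pseudo_metric (udist A' dB')" by (rule U.ext_pseudo_metric_axioms)
  show "map_closure A A' dA' j B' dB' b F \<subseteq> A' \<rightarrow>\<^sub>E B'" using map_closureD(1) by blast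
  fix h
  assume h: "h \<in> A' \<rightarrow>\<^sub>E B'"
    and ap: "\<And>e. e > 0 \<Longrightarrow> \<exists>t\<in>map_closure A A' dA' j B' dB' b F. udist A' dB' h t < ennreal e"
  show "h \<in> map_closure A A' dA' j B' dB' b F"
  proof (rule map_closureI)
    show "h \<in> extensional A'" using h by (simp add: PiE_def)
    show "h \<in> nonexp A' dA' B' dB'"
    proof (rule nonexpI)
      show "h y \<in> B'" if "y \<in> A'" for y using h that by auto
      fix y z assume y: "y \<in> A'" and z: "z \<in> A'"
      show "dB' (h y) (h z) \<le> dA' y z"
      proof (rule ennreal_le_epsilon)
        fix e :: real assume e: "e > 0"
        then obtain t where t: "t \<in> map_closure A A' dA' j B' dB' b F" "udist A' dB' h t < ennreal (e/2)"
          using ap half_gt_zero by blast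
        have "dB' (h y) (h z) \<le> dB' (h y) (t y) + dB' (t y) (t z) + dB' (t z) (h z)"
          by (rule B.tri4)
        also have "\<dots> \<le> ennreal (e/2) + dA' y z + ennreal (e/2)"
          using udist_lessD[OF t(2) y] udist_lessD[OF t(2) z] B.sym[of "h z"]
            nonexp_le[OF map_closureD(2)[OF t(1)] y z]
          by (intro add_mono) auto
        also have "\<dots> = dA' y z + (ennreal (e/2) + ennreal (e/2))" by (simp add: ac_simps)
        also have "ennreal (e/2) + ennreal (e/2) = ennreal e"
          using e by (simp flip: ennreal_plus)
        finally show "dB' (h y) (h z) \<le> dA' y z + ennreal e" .
      qed
    qed
    fix e :: real assume e: "e > 0"
    then obtain t where t: "t \<in> map_closure A A' dA' j B' dB' b F" "udist A' dB' h t < ennreal (e/2)"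
      using ap half_gt_zero by blast
    obtain f where f: "f \<in> F" "udist A dB' (\<lambda>x. t (j x)) (\<lambda>x. b (f x)) < ennreal (e/2)"
      using map_closureD(3)[OF t(1)] e half_gt_zero by blast
    have "udist A dB' (\<lambda>x. h (j x)) (\<lambda>x. t (j x)) \<le> udist A' dB' h t"
      using j by (intro udist_least udist_upper) auto
    then have "udist A dB' (\<lambda>x. h (j x)) (\<lambda>x. b (f x)) < ennreal (e/2 + e/2)"
      using t(2) f(2) by (intro V.tri_less) auto
    then show "\<exists>f\<in>F. udist A dB' (\<lambda>x. h (j x)) (\<lambda>x. b (f x)) < ennreal e"
      using f(1) by auto
  qed
qed

text \<open>
  Restriction to the dense image of \<open>A\<close> preserves uniform distances of nonexpansive maps, by
  \<open>udist_nonexp_dense\<close>. So extending is isometric, and density of the extensions is the very definition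
  of \<open>map_closure\<close>.
\<close>

lemma map_closure_is_completion:
  assumes dA': "ext_pseudo_metric dA'" and dB': "ext_pseudo_metric dB'"
    and cA: "is_completion A dA A' dA' j" and cB: "is_completion B dB B' dB' b"
    and F: "F \<subseteq> nonexp A dA B dB"
  obtains E where
    "is_completion F (udist A dB) (map_closure A A' dA' j B' dB' b F) (udist A' dB') E"
    "\<And>f x. f \<in> F \<Longrightarrow> x \<in> A \<Longrightarrow> E f (j x) = b (f x)"
proof -
  note DA = is_completionD[OF cA] and DB = is_completionD[OF cB]
  let ?M = "map_closure A A' dA' j B' dB' b F"
  interpret U: ext_pseudo_metric "udist A dB'" by (rule ext_pseudo_metric_udist) fact
  have bf: "(\<lambda>x. b (f x)) \<in> nonexp A dA B' dB'" if "f \<in> F" for f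
    using that F DB(1,2) by (intro nonexpI) (auto simp: nonexp_mem nonexp_le subset_iff)
  have "\<exists>h. h \<in> nonexp A' dA' B' dB' \<and> h \<in> A' \<rightarrow>\<^sub>E B' \<and> (\<forall>x\<in>A. h (j x) = b (f x))" if "f \<in> F" for f
    using nonexp_extends_to_completion[OF dA' dB' cA DB(4,5) bf[OF that]] by metis
  then obtain E where E: "\<And>f. f \<in> F \<Longrightarrow> E f \<in> nonexp A' dA' B' dB'" "\<And>f. f \<in> F \<Longrightarrow> E f \<in> A' \<rightarrow>\<^sub>E B'"
    "\<And>f x. f \<in> F \<Longrightarrow> x \<in> A \<Longrightarrow> E f (j x) = b (f x)"
    by metis
  have Eb: "udist A dB' g (\<lambda>x. E f (j x)) = udist A dB' g (\<lambda>x. b (f x))" if "f \<in> F" for f g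
    using E(3)[OF that] by (intro udist_cong) simp
  have "is_completion F (udist A dB) ?M (udist A' dB') E"
    unfolding is_completion_def
  proof (intro conjI ballI allI impI)
    have "E f \<in> ?M" if f: "f \<in> F" for f
    proof (rule map_closureI)
      show "E f \<in> extensional A'" using E(2)[OF f] by (simp add: PiE_def)
      have "udist A dB' (\<lambda>x. E f (j x)) (\<lambda>x. b (f x)) = 0"
        using Eb[OF f, of "\<lambda>x. E f (j x)"] U.refl[of "\<lambda>x. E f (j x)"] by order
      then show "\<exists>f'\<in>F. udist A dB' (\<lambda>x. E f (j x)) (\<lambda>x. b (f' x)) < ennreal e" if "e > 0" for e
        using that f by (intro bexI[of _ f]) auto
    qed (rule E(1)[OF f])
    then show "E \<in> F \<rightarrow> ?M" by blast
    show "udist A' dB' (E f) (E g) = udist A dB f g" if f: "f \<in> F" and g: "g \<in> F" for f g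
    proof -
      have "udist A' dB' (E f) (E g) = udist A dB' (\<lambda>x. E f (j x)) (\<lambda>x. E g (j x))"
        by (rule udist_nonexp_dense[OF dA' dB' cA E(1)[OF f] E(1)[OF g]])
      also have "\<dots> = udist A dB f g"
        using E(3) f g DB(2) F nonexp_mem[of _ A dA B dB] by (intro udist_cong) (auto simp: subset_iff)
      finally show ?thesis .
    qed
    show "\<exists>f\<in>F. udist A' dB' h (E f) < ennreal e" if h: "h \<in> ?M" and e: "e > 0" for h e
    proof -
      obtain f where f: "f \<in> F" "udist A dB' (\<lambda>x. h (j x)) (\<lambda>x. b (f x)) < ennreal e"
        using map_closureD(3)[OF h e] by blast
      then show ?thesis
        using udist_nonexp_dense[OF dA' dB' cA map_closureD(2)[OF h] E(1)[OF f(1)]] Eb[OF f(1), of "\<lambda>x. h (j x)"]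
        by (intro bexI[OF _ f(1)]) simp
    qed
    show "complete_on (udist A' dB') ?M"
      by (rule complete_on_map_closure[OF dA' dB' DB(4)]) (simp add: DA(1))
    show "separated (udist A' dB') ?M"
      by (rule separated_subset[OF separated_udist[OF DB(5)]]) (auto dest: map_closureD(1))
  qed
  then show thesis using that E(3) by blast
qed

text \<open>
  Composition is jointly continuous for uniform distances as soon as the outer maps are nonexpansive.
\<close>

lemma udist_compose_less:
  assumes "ext_pseudo_metric dC" and f: "f \<in> A \<rightarrow> B" "f' \<in> A \<rightarrow> B" and g': "g' \<in> nonexp B dB C dC"
    and 1: "udist A dB f f' < ennreal a" and 2: "udist B dC g g' < ennreal b"
  shows "udist A dC (compose A g f) (compose A g' f') < ennreal (a + b)"
proof -
  interpret C: ext_pseudo_metric dC by fact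
  have "udist A dC (compose A g f) (compose A g' f') \<le> udist A dB f f' + udist B dC g g'"
  proof (rule udist_least)
    fix x assume x: "x \<in> A"
    have "dC (g (f x)) (g' (f' x)) \<le> dC (g (f x)) (g' (f x)) + dC (g' (f x)) (g' (f' x))"
      by (rule C.tri)
    also have "\<dots> \<le> udist B dC g g' + udist A dB f f'"
    proof (rule add_mono)
      show "dC (g (f x)) (g' (f x)) \<le> udist B dC g g'" using x f by (intro udist_upper) auto
      have "dC (g' (f x)) (g' (f' x)) \<le> dB (f x) (f' x)" using x f by (intro nonexp_le[OF g']) auto
      also have "\<dots> \<le> udist A dB f f'" by (rule udist_upper[OF x])
      finally show "dC (g' (f x)) (g' (f' x)) \<le> udist A dB f f'" .
    qed
    finally show "dC (compose A g f x) (compose A g' f' x) \<le> udist A dB f f' + udist B dC g g'"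
      using x by (simp add: compose_def add.commute)
  qed
  then show ?thesis using less_add_ennreal[OF 1 2] by (rule order_le_less_trans)
qed

lemma nonexp_compose:
  assumes f: "f \<in> nonexp A dA B dB" and g: "g \<in> nonexp B dB C dC"
  shows "compose A g f \<in> nonexp A dA C dC"
proof (rule nonexpI)
  show "compose A g f x \<in> C" if "x \<in> A" for x
    using nonexp_mem[OF g nonexp_mem[OF f that]] that by (simp add: compose_def)
  show "dC (compose A g f x) (compose A g f y) \<le> dA x y" if x: "x \<in> A" and y: "y \<in> A" for x y
    using nonexp_le[OF g nonexp_mem[OF f x] nonexp_mem[OF f y]] nonexp_le[OF f x y] x y
    by (simp add: compose_def)
qed

text \<open>
  Closure of \<open>G'\<close> under multiplication and the action of \<open>G'\<close> on \<open>\<Phi>'\<close> are both instances.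
\<close>

lemma map_closure_compose:
  assumes "ext_pseudo_metric dC'" and b: "b \<in> B \<rightarrow> B'" and j: "j \<in> A \<rightarrow> A'" and F: "F \<subseteq> A \<rightarrow> B"
    and f: "f \<in> map_closure A A' dA' j B' dB' b F" and g: "g \<in> map_closure B B' dB' b C' dC' c G"
    and K: "\<And>f g. f \<in> F \<Longrightarrow> g \<in> G \<Longrightarrow> compose A g f \<in> K"
  shows "compose A' g f \<in> map_closure A A' dA' j C' dC' c K"
proof (rule map_closureI)
  interpret C: ext_pseudo_metric dC' by fact
  show "compose A' g f \<in> extensional A'" by (rule compose_extensional)
  show "compose A' g f \<in> nonexp A' dA' C' dC'"
    using map_closureD(2)[OF f] map_closureD(2)[OF g] by (rule nonexp_compose)
  fix e :: real assume e: "e > 0"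
  then have e3: "e/3 > 0" by simp
  obtain f0 where f0: "f0 \<in> F" "udist A dB' (\<lambda>x. f (j x)) (\<lambda>x. b (f0 x)) < ennreal (e/3)"
    using map_closureD(3)[OF f e3] by blast
  obtain g0 where g0: "g0 \<in> G" "udist B dC' (\<lambda>x. g (b x)) (\<lambda>x. c (g0 x)) < ennreal (e/3)"
    using map_closureD(3)[OF g e3] by blast
  have "udist A dC' (\<lambda>x. compose A' g f (j x)) (\<lambda>x. c (compose A g0 f0 x)) < ennreal e"
  proof (rule udist_less)
    show "0 < 2*e/3" "2*e/3 < e" using e by auto
    fix x assume x: "x \<in> A"
    have jx: "j x \<in> A'" and f0x: "f0 x \<in> B" using x j F f0 by auto
    then have "f (j x) \<in> B'" "b (f0 x) \<in> B'" using map_closureD(1)[OF f] b by auto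
    then have "dC' (g (f (j x))) (g (b (f0 x))) < ennreal (e/3)"
      using udist_lessD[OF f0(2) x] by (rule nonexp_less[OF map_closureD(2)[OF g]])
    then have "dC' (g (f (j x))) (c (g0 (f0 x))) < ennreal (e/3 + e/3)"
      using udist_lessD[OF g0(2) f0x] by (rule C.tri_less)
    then show "dC' (compose A' g f (j x)) (c (compose A g0 f0 x)) < ennreal (2*e/3)"
      using x jx by (simp add: compose_def)
  qed
  then show "\<exists>k\<in>K. udist A dC' (\<lambda>x. compose A' g f (j x)) (\<lambda>x. c (k x)) < ennreal e"
    using K[OF f0(1) g0(1)] by blast
qed

section \<open>The Kuratowski completion\<close>

definition rdist :: "real \<Rightarrow> real \<Rightarrow> ennreal" where
  "rdist x y = ennreal \<bar>x - y\<bar>"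

lemma rdist_less: "rdist x y < ennreal e \<longleftrightarrow> \<bar>x - y\<bar> < e"
  by (simp add: rdist_def ennreal_less_iff)

lemma ext_pseudo_metric_rdist: "ext_pseudo_metric rdist"
proof
  show "rdist x z \<le> rdist x y + rdist y z" for x y z
    unfolding rdist_def by (simp flip: ennreal_plus)
qed (auto simp: rdist_def abs_minus_commute)

lemma is_completion_rdist: "is_completion UNIV rdist UNIV rdist (\<lambda>x. x)"
  unfolding is_completion_def
proof (intro conjI)
  show "complete_on rdist UNIV"
    unfolding complete_on_def rdist_less
  proof (intro allI impI)
    fix \<sigma> :: "nat \<Rightarrow> real" assume "\<forall>e>0. \<exists>N. \<forall>m\<ge>N. \<forall>n\<ge>N. \<bar>\<sigma> m - \<sigma> n\<bar> < e"
    then have "Cauchy \<sigma>" by (simp add: Cauchy_def dist_real_def)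
    then obtain l where "\<sigma> \<longlonglongrightarrow> l" by (auto simp: Cauchy_convergent_iff convergent_def)
    then show "\<exists>l\<in>UNIV. \<forall>e>0. \<exists>N. \<forall>n\<ge>N. \<bar>\<sigma> n - l\<bar> < e" by (auto simp: LIMSEQ_iff)
  qed
  show "\<forall>y\<in>UNIV. \<forall>e>0. \<exists>x\<in>UNIV. rdist y x < ennreal e"
  proof (intro ballI allI impI)
    show "\<exists>x\<in>UNIV. rdist y x < ennreal e" if "e > 0" for y e
      using that by (intro bexI[of _ y]) (simp_all add: rdist_less)
  qed
qed (auto simp: separated_def rdist_def)

lemma totally_bdd_rdist: "totally_bdd rdist {- M..M}"
proof -
  interpret ext_pseudo_metric rdist by (rule ext_pseudo_metric_rdist)
  show ?thesis
  proof (rule totally_bddI_finite_colouring)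
    fix e :: real assume e: "e > 0"
    show "\<exists>c :: real \<Rightarrow> int. finite (c ` {- M..M}) \<and>
      (\<forall>x\<in>{- M..M}. \<forall>y\<in>{- M..M}. c x = c y \<longrightarrow> rdist x y < ennreal e)"
    proof (intro exI[of _ "\<lambda>x. \<lfloor>x / e\<rfloor>"] conjI ballI impI)
      have "(\<lambda>x. \<lfloor>x / e\<rfloor>) ` {- M..M} \<subseteq> {\<lfloor>- M / e\<rfloor>..\<lfloor>M / e\<rfloor>}"
        using e divide_right_mono[of "- M" _ e] divide_right_mono[of _ M e]
        by (force intro!: floor_mono)
      then show "finite ((\<lambda>x. \<lfloor>x / e\<rfloor>) ` {- M..M})" using finite_subset by blast
      fix x y assume "\<lfloor>x / e\<rfloor> = \<lfloor>y / e\<rfloor>"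
      then have "\<bar>x / e - y / e\<bar> < 1" by linarith
      then have "\<bar>x - y\<bar> < e"
        using e by (simp add: diff_divide_distrib[symmetric])
      then show "rdist x y < ennreal e" by (simp add: rdist_less)
    qed
  qed
qed

text \<open>
  The map \<open>x \<mapsto> d x\<close> is isometric for the uniform distance by the triangle inequality, and the functions on
  \<open>X\<close> are complete, so the closure of its image is a completion.
\<close>

lemma kuratowski_completion:
  assumes "ext_pseudo_metric d" and fin: "\<And>x y. x \<in> X \<Longrightarrow> y \<in> X \<Longrightarrow> d x y < \<infinity>"
  obtains X' j where "is_completion X d X' (udist X rdist) j"
proof -
  interpret ext_pseudo_metric d by fact
  interpret R: ext_pseudo_metric rdist by (rule ext_pseudo_metric_rdist)
  interpret U: ext_pseudo_metric "udist X rdist" by (rule ext_pseudo_metric_udist) unfold_locales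
  note R = is_completionD[OF is_completion_rdist]
  define j where "j x = (\<lambda>z\<in>X. enn2real (d x z))" for x
  define X' where "X' = {a \<in> X \<rightarrow>\<^sub>E UNIV. \<forall>e>0. \<exists>x\<in>X. udist X rdist a (j x) < ennreal e}"
  have iso: "udist X rdist (j x) (j y) = d x y" if x: "x \<in> X" and y: "y \<in> X" for x y
  proof (rule antisym)
    show "udist X rdist (j x) (j y) \<le> d x y"
    proof (rule udist_least)
      fix z assume z: "z \<in> X"
      obtain p q r where p: "d x z = ennreal p" "p \<ge> 0" and q: "d y z = ennreal q" "q \<ge> 0"
        and r: "d x y = ennreal r" "r \<ge> 0"
        using fin[OF x z] fin[OF y z] fin[OF x y] by (auto simp: less_top_ennreal)
      have "p \<le> r + q" using tri[of x z y] p q r by (simp flip: ennreal_plus)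
      moreover have "q \<le> r + p" using tri[of y z x] sym[of y x] p q r by (simp flip: ennreal_plus)
      ultimately show "rdist (j x z) (j y z) \<le> d x y"
        using z p q r by (simp add: rdist_def j_def)
    qed
    \<comment> \<open>The supremum is attained at \<open>z = y\<close>.\<close>
    have "d x y = rdist (j x y) (j y y)"
      using fin[OF x y] y refl by (simp add: rdist_def j_def)
    also have "\<dots> \<le> udist X rdist (j x) (j y)" using y by (rule udist_upper)
    finally show "d x y \<le> udist X rdist (j x) (j y)" .
  qed
  have "is_completion X d X' (udist X rdist) j"
    unfolding is_completion_def
  proof (intro conjI)
    have "udist X rdist (j x) (j x) < ennreal e" if "e > 0" for e x using that U.refl by simp
    then show "j \<in> X \<rightarrow> X'" by (auto simp: X'_def j_def) blast
    show "\<forall>x\<in>X. \<forall>y\<in>X. udist X rdist (j x) (j y) = d x y" using iso by blast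
    show "\<forall>y\<in>X'. \<forall>e>0. \<exists>x\<in>X. udist X rdist y (j x) < ennreal e" by (auto simp: X'_def)
    show "separated (udist X rdist) X'"
      by (rule separated_subset[OF separated_udist[OF R(5)]]) (auto simp: X'_def)
    show "complete_on (udist X rdist) X'"
    proof (rule complete_on_closed_subset[OF complete_on_udist[OF R.ext_pseudo_metric_axioms R(4)]])
      show "X' \<subseteq> X \<rightarrow>\<^sub>E UNIV" by (auto simp: X'_def)
      show "ext_pseudo_metric (udist X rdist)" by unfold_locales
      fix y assume y: "y \<in> X \<rightarrow>\<^sub>E UNIV" and ap: "\<And>e. e > 0 \<Longrightarrow> \<exists>t\<in>X'. udist X rdist y t < ennreal e"
      have "\<exists>x\<in>X. udist X rdist y (j x) < ennreal e" if e: "e > 0" for e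
      proof -
        obtain t where t: "t \<in> X'" "udist X rdist y t < ennreal (e/2)" using ap[of "e/2"] e by auto
        have "\<forall>e>0. \<exists>x\<in>X. udist X rdist t (j x) < ennreal e" using t(1) by (simp add: X'_def)
        moreover have "e/2 > 0" using e by simp
        ultimately obtain x where x: "x \<in> X" "udist X rdist t (j x) < ennreal (e/2)" by blast
        have "udist X rdist y (j x) < ennreal (e/2 + e/2)" by (rule U.tri_less[OF t(2) x(2)])
        then show ?thesis using x(1) by auto
      qed
      then show "y \<in> X'" using y by (simp add: X'_def)
    qed
  qed
  then show thesis by (rule that)
qed

section \<open>Perception pairs\<close>

lemma perception_pairD:
  assumes "perception_pair X \<Phi> G"
  shows "data_set X \<Phi>" "G \<subseteq> Bij X" "(\<lambda>x\<in>X. x) \<in> G"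
    and "\<And>g h. g \<in> G \<Longrightarrow> h \<in> G \<Longrightarrow> compose X g h \<in> G"
    and "\<And>g. g \<in> G \<Longrightarrow> \<exists>h\<in>G. compose X g h = (\<lambda>x\<in>X. x) \<and> compose X h g = (\<lambda>x\<in>X. x)"
    and "\<And>\<phi> g. \<phi> \<in> \<Phi> \<Longrightarrow> g \<in> G \<Longrightarrow> compose X \<phi> g \<in> \<Phi>"
proof -
  show D: "data_set X \<Phi>" using assms by (simp add: perception_pair_def)
  have S: "subgroup G (Aut_group X \<Phi>)" using assms by (simp add: perception_pair_def)
  interpret A: group "Aut_group X \<Phi>" by (rule group_Aut_group[OF D])
  have sub: "G \<subseteq> carrier (Aut_group X \<Phi>)" using S by (rule subgroup.subset)
  then show B: "G \<subseteq> Bij X" and "\<And>\<phi> g. \<phi> \<in> \<Phi> \<Longrightarrow> g \<in> G \<Longrightarrow> compose X \<phi> g \<in> \<Phi>"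
    by (auto simp: Aut_group_def)
  have mult: "g \<otimes>\<^bsub>Aut_group X \<Phi>\<^esub> h = compose X g h" if "g \<in> G" "h \<in> G" for g h
    using that B by (auto simp: Aut_group_def BijGroup_def)
  have one: "\<one>\<^bsub>Aut_group X \<Phi>\<^esub> = (\<lambda>x\<in>X. x)" by (simp add: Aut_group_def BijGroup_def)
  show "(\<lambda>x\<in>X. x) \<in> G" using subgroup.one_closed[OF S] one by simp
  show "compose X g h \<in> G" if "g \<in> G" "h \<in> G" for g h
    using subgroup.m_closed[OF S that] mult[OF that] by simp
  show "\<exists>h\<in>G. compose X g h = (\<lambda>x\<in>X. x) \<and> compose X h g = (\<lambda>x\<in>X. x)" if g: "g \<in> G" for g
  proof -
    have i: "inv\<^bsub>Aut_group X \<Phi>\<^esub> g \<in> G" by (rule subgroup.m_inv_closed[OF S g])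
    have "g \<in> carrier (Aut_group X \<Phi>)" using g sub by blast
    then show ?thesis
      using A.r_inv[of g] A.l_inv[of g] mult[OF g i] mult[OF i g] one i by auto
  qed
qed

text \<open>
  The group axioms in terms of composition, avoiding the inverse operation of the group of all
  bijections: bijectivity and the value of the inverse both follow from a two-sided inverse in \<open>G\<close>.
\<close>

lemma perception_pairI:
  assumes D: "data_set X \<Phi>" and ext: "G \<subseteq> X \<rightarrow>\<^sub>E X" and id: "(\<lambda>x\<in>X. x) \<in> G"
    and mult: "\<And>g h. g \<in> G \<Longrightarrow> h \<in> G \<Longrightarrow> compose X g h \<in> G"
    and inv: "\<And>g. g \<in> G \<Longrightarrow> \<exists>h\<in>G. compose X g h = (\<lambda>x\<in>X. x) \<and> compose X h g = (\<lambda>x\<in>X. x)"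
    and act: "\<And>\<phi> g. \<phi> \<in> \<Phi> \<Longrightarrow> g \<in> G \<Longrightarrow> compose X \<phi> g \<in> \<Phi>"
  shows "perception_pair X \<Phi> G"
proof -
  interpret A: group "Aut_group X \<Phi>" by (rule group_Aut_group[OF D])
  interpret B: group "BijGroup X" by (rule group_BijGroup)
  obtain v where v: "\<And>g. g \<in> G \<Longrightarrow> v g \<in> G" "\<And>g. g \<in> G \<Longrightarrow> compose X g (v g) = (\<lambda>x\<in>X. x)"
    "\<And>g. g \<in> G \<Longrightarrow> compose X (v g) g = (\<lambda>x\<in>X. x)"
    using inv by metis
  have Bij: "g \<in> Bij X" if g: "g \<in> G" for g
  proof -
    have "g (v g x) = x" "v g (g x) = x" if "x \<in> X" for x
      using fun_cong[OF v(2)[OF g], of x] fun_cong[OF v(3)[OF g], of x] that by (simp_all add: compose_def)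
    moreover have "g \<in> X \<rightarrow>\<^sub>E X" "v g \<in> X \<rightarrow>\<^sub>E X" using g v(1) ext by auto
    ultimately have "bij_betw g X X"
      by (intro bij_betw_byWitness[of X "v g"]) auto
    then show ?thesis using ext g by (auto simp: Bij_def PiE_def)
  qed
  have inv_B: "inv\<^bsub>BijGroup X\<^esub> g = v g" if g: "g \<in> G" for g
    using v[OF g] Bij[OF g] Bij[OF v(1)[OF g]]
    by (intro B.inv_equality) (simp_all add: BijGroup_def)
  have sub: "G \<subseteq> carrier (Aut_group X \<Phi>)"
    using Bij inv_B v(1) act by (auto simp: Aut_group_def)
  have mult': "g \<otimes>\<^bsub>Aut_group X \<Phi>\<^esub> h = compose X g h" if "g \<in> G" "h \<in> G" for g h
    using that Bij by (simp add: Aut_group_def BijGroup_def)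
  have inv_A: "inv\<^bsub>Aut_group X \<Phi>\<^esub> g = v g" if g: "g \<in> G" for g
  proof (rule A.inv_equality)
    show "v g \<otimes>\<^bsub>Aut_group X \<Phi>\<^esub> g = \<one>\<^bsub>Aut_group X \<Phi>\<^esub>"
      using mult'[OF v(1)[OF g] g] v(3)[OF g] by (simp add: Aut_group_def BijGroup_def)
  qed (use sub g v(1) in auto)
  have "subgroup G (Aut_group X \<Phi>)"
    by (rule A.subgroupI) (use sub id mult mult' inv_A v(1) in auto)
  then show ?thesis using D by (simp add: perception_pair_def)
qed

lemma perception_group_simps:
  assumes "perception_pair X \<Phi> G"
  shows "carrier (perception_group X \<Phi> G) = G"
    and "\<And>g h. g \<in> G \<Longrightarrow> h \<in> G \<Longrightarrow> g \<otimes>\<^bsub>perception_group X \<Phi> G\<^esub> h = compose X g h"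
  using perception_pairD(2)[OF assms] by (auto simp: perception_group_def Aut_group_def BijGroup_def)

lemma hom_perception_group_iff:
  assumes "perception_pair X \<Phi> G" "perception_pair Y \<Psi> H"
  shows "T \<in> hom (perception_group X \<Phi> G) (perception_group Y \<Psi> H) \<longleftrightarrow>
    T \<in> G \<rightarrow> H \<and> (\<forall>g\<in>G. \<forall>h\<in>G. T (compose X g h) = compose Y (T g) (T h))"
  using perception_group_simps[OF assms(1)] perception_group_simps[OF assms(2)]
  by (auto simp: hom_def Pi_iff)

lemma D_data_eq_udist:
  assumes "data_set X \<Phi>" "\<phi> \<in> \<Phi>" "\<psi> \<in> \<Phi>"
  shows "D_data X \<phi> \<psi> = udist X rdist \<phi> \<psi>"
proof -
  have ne: "X \<noteq> {}" and "bounded (\<phi> ` X)" "bounded (\<psi> ` X)"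
    using assms by (auto simp: data_set_iff)
  then obtain a b where a: "\<And>x. x \<in> X \<Longrightarrow> \<bar>\<phi> x\<bar> \<le> a" and b: "\<And>x. x \<in> X \<Longrightarrow> \<bar>\<psi> x\<bar> \<le> b"
    unfolding bounded_real by blast
  have "\<bar>\<phi> x - \<psi> x\<bar> \<le> a + b" if "x \<in> X" for x
    using a[OF that] b[OF that] by linarith
  then have bdd: "bdd_above ((\<lambda>x. \<bar>\<phi> x - \<psi> x\<bar>) ` X)"
    by (auto intro!: bdd_aboveI)
  have fd: "D_data X \<phi> \<psi> = ennreal (SUP x\<in>X. \<bar>\<phi> x - \<psi> x\<bar>)"
    unfolding D_data_def using fdist_data_set[OF assms] by simp
  show ?thesis
  proof (rule antisym)
    show "udist X rdist \<phi> \<psi> \<le> D_data X \<phi> \<psi>"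
      unfolding fd rdist_def using cSUP_upper[OF _ bdd] by (intro udist_least ennreal_leI) auto
    show "D_data X \<phi> \<psi> \<le> udist X rdist \<phi> \<psi>"
    proof (cases "udist X rdist \<phi> \<psi>")
      case (real r)
      have "\<bar>\<phi> x - \<psi> x\<bar> \<le> r" if "x \<in> X" for x
        using udist_upper[OF that, of rdist \<phi> \<psi>] real by (simp add: rdist_def)
      then have "(SUP x\<in>X. \<bar>\<phi> x - \<psi> x\<bar>) \<le> r" using ne by (rule cSUP_least[rotated])
      then show ?thesis using real fd by (simp add: ennreal_leI)
    qed simp
  qed
qed

lemma D_pt_eq_udist: "D_pt \<Phi> x y = udist \<Phi> rdist (\<lambda>\<phi>. \<phi> x) (\<lambda>\<phi>. \<phi> y)"
  by (simp add: D_pt_def udist_def rdist_def)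

lemma ext_pseudo_metric_D_pt: "ext_pseudo_metric (D_pt \<Phi>)"
proof -
  interpret U: ext_pseudo_metric "udist \<Phi> rdist"
    by (rule ext_pseudo_metric_udist[OF ext_pseudo_metric_rdist])
  show ?thesis unfolding D_pt_eq_udist by unfold_locales (rule U.refl U.sym U.tri)+
qed

lemma rdist_le_D_pt: "\<phi> \<in> \<Phi> \<Longrightarrow> rdist (\<phi> x) (\<phi> y) \<le> D_pt \<Phi> x y"
  unfolding D_pt_eq_udist by (rule udist_upper)

lemma data_nonexp: "\<Phi> \<subseteq> nonexp X (D_pt \<Phi>) UNIV rdist"
  by (auto intro!: nonexpI rdist_le_D_pt)

text \<open>
  Exchanging the suprema over \<open>\<Phi>\<close> and \<open>X\<close> shows that group elements are compared as maps \<open>X \<rightarrow> X\<close>.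
\<close>

lemma D_Aut_eq_udist:
  assumes pp: "perception_pair X \<Phi> G" and g: "g \<in> G" and h: "h \<in> G"
  shows "D_Aut X \<Phi> g h = udist X (D_pt \<Phi>) g h"
proof -
  have "D_Aut X \<Phi> g h = (SUP \<phi>\<in>\<Phi>. udist X rdist (compose X \<phi> g) (compose X \<phi> h))"
    unfolding D_Aut_def
    using D_data_eq_udist[OF perception_pairD(1)[OF pp]] perception_pairD(6)[OF pp] g h
    by (intro SUP_cong) auto
  also have "\<dots> = (SUP \<phi>\<in>\<Phi>. SUP x\<in>X. rdist (\<phi> (g x)) (\<phi> (h x)))"
    unfolding udist_def by (intro SUP_cong) (auto simp: compose_def)
  also have "\<dots> = (SUP x\<in>X. SUP \<phi>\<in>\<Phi>. rdist (\<phi> (g x)) (\<phi> (h x)))" by (rule SUP_commute)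
  also have "\<dots> = udist X (D_pt \<Phi>) g h" by (simp add: udist_def D_pt_eq_udist)
  finally show ?thesis .
qed

text \<open>
  Since \<open>\<phi> \<circ> g\<close> is in \<open>\<Phi>\<close>, the supremum that defines the distance of \<open>g x\<close> and \<open>g y\<close> runs over part of
  the values that define the distance of \<open>x\<close> and \<open>y\<close>.
\<close>

lemma perception_group_nonexp:
  assumes pp: "perception_pair X \<Phi> G"
  shows "G \<subseteq> nonexp X (D_pt \<Phi>) X (D_pt \<Phi>)"
proof
  fix g assume g: "g \<in> G"
  show "g \<in> nonexp X (D_pt \<Phi>) X (D_pt \<Phi>)"
  proof (rule nonexpI)
    show "g x \<in> X" if "x \<in> X" for x
      using perception_pairD(2)[OF pp] g Bij_imp_funcset that by blast
    show "D_pt \<Phi> (g x) (g y) \<le> D_pt \<Phi> x y" if x: "x \<in> X" and y: "y \<in> X" for x y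
      unfolding D_pt_eq_udist[of _ "g x"]
    proof (rule udist_least)
      fix \<phi> assume "\<phi> \<in> \<Phi>"
      then have "rdist (compose X \<phi> g x) (compose X \<phi> g y) \<le> D_pt \<Phi> x y"
        using perception_pairD(6)[OF pp _ g] by (intro rdist_le_D_pt)
      then show "rdist (\<phi> (g x)) (\<phi> (g y)) \<le> D_pt \<Phi> x y" using x y by (simp add: compose_def)
    qed
  qed
qed

lemma separated_data:
  assumes "data_set X \<Phi>" shows "separated (udist X rdist) \<Phi>"
  by (rule separated_subset[OF separated_udist[OF is_completionD(5)[OF is_completion_rdist]]])
    (use assms in \<open>auto simp: data_set_iff PiE_def\<close>)

lemma separated_perception_group:
  assumes "perception_pair X \<Phi> G" "separated (D_pt \<Phi>) X"
  shows "separated (udist X (D_pt \<Phi>)) G"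
  by (rule separated_subset[OF separated_udist[OF assms(2)]])
    (use perception_pairD(2)[OF assms(1)] in \<open>auto simp: PiE_def dest: Bij_imp_extensional Bij_imp_funcset\<close>)

lemma totally_bdd_data:
  assumes "data_set X \<Phi>" "data_totally_bounded X \<Phi>"
  shows "totally_bdd (udist X rdist) \<Phi>"
  unfolding totally_bdd_def
proof (intro allI impI)
  interpret M: Metric_space "Met_TC.fspace X" "Met_TC.fdist X" by (rule Met_TC.Metric_space_funspace)
  interpret U: ext_pseudo_metric "udist X rdist"
    by (rule ext_pseudo_metric_udist[OF ext_pseudo_metric_rdist])
  fix e :: real assume e: "e > 0"
  have "\<forall>e>0. \<exists>K. finite K \<and> K \<subseteq> \<Phi> \<and> \<Phi> \<subseteq> (\<Union>x\<in>K. M.mball x e)"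
    using assms(2) unfolding data_totally_bounded_def M.mtotally_bounded_def .
  then obtain K where K: "finite K" "K \<subseteq> \<Phi>" "\<Phi> \<subseteq> (\<Union>x\<in>K. M.mball x e)"
    using e by meson
  have "\<exists>k\<in>K. udist X rdist \<phi> k < ennreal e" if \<phi>: "\<phi> \<in> \<Phi>" for \<phi>
  proof -
    obtain k where k: "k \<in> K" "Met_TC.fdist X k \<phi> < e" using K(3) \<phi> by (auto simp: M.mball_def)
    then have "D_data X k \<phi> < ennreal e" by (simp add: D_data_def ennreal_less_iff M.nonneg)
    then show ?thesis
      using D_data_eq_udist[OF assms(1) _ \<phi>] k(1) K(2) U.sym by (metis subsetD)
  qed
  then show "\<exists>K. finite K \<and> K \<subseteq> \<Phi> \<and> (\<forall>x\<in>\<Phi>. \<exists>k\<in>K. udist X rdist x k < ennreal e)"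
    using K by blast
qed

lemma totally_bdd_data_uniformly_bounded:
  assumes D: "data_set X \<Phi>" and tb: "totally_bdd (udist X rdist) \<Phi>"
  obtains M where "\<And>\<phi> x. \<phi> \<in> \<Phi> \<Longrightarrow> x \<in> X \<Longrightarrow> \<bar>\<phi> x\<bar> \<le> M"
proof -
  obtain K where K: "finite K" "K \<subseteq> \<Phi>" "\<And>\<phi>. \<phi> \<in> \<Phi> \<Longrightarrow> \<exists>k\<in>K. udist X rdist \<phi> k < ennreal 1"
    using tb unfolding totally_bdd_def by (meson zero_less_one)
  have "bounded (\<Union>k\<in>K. k ` X)"
    using K(1,2) D by (intro bounded_UN) (auto simp: data_set_iff)
  then obtain M where M: "\<And>k x. k \<in> K \<Longrightarrow> x \<in> X \<Longrightarrow> \<bar>k x\<bar> \<le> M"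
    unfolding bounded_real by blast
  have "\<bar>\<phi> x\<bar> \<le> M + 1" if "\<phi> \<in> \<Phi>" and x: "x \<in> X" for \<phi> x
  proof -
    obtain k where k: "k \<in> K" "udist X rdist \<phi> k < ennreal 1" using K(3) \<open>\<phi> \<in> \<Phi>\<close> by blast
    show ?thesis using udist_lessD[OF k(2) x] M[OF k(1) x] by (simp add: rdist_less del: ennreal_1)
  qed
  then show thesis by (rule that)
qed

text \<open>
  Points are evaluation maps from \<open>\<Phi>\<close> to a bounded interval.
\<close>

lemma totally_bdd_points:
  assumes D: "data_set X \<Phi>" and tb: "totally_bdd (udist X rdist) \<Phi>"
  shows "totally_bdd (D_pt \<Phi>) X"
proof -
  obtain M where M: "\<And>\<phi> x. \<phi> \<in> \<Phi> \<Longrightarrow> x \<in> X \<Longrightarrow> \<bar>\<phi> x\<bar> \<le> M"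
    using totally_bdd_data_uniformly_bounded[OF assms] by blast
  have U: "ext_pseudo_metric (udist A rdist)" for A :: "'c set"
    by (rule ext_pseudo_metric_udist[OF ext_pseudo_metric_rdist])
  have "(\<lambda>x \<phi>. \<phi> x) ` X \<subseteq> nonexp \<Phi> (udist X rdist) {- M..M} rdist"
    using M by (auto intro!: nonexpI udist_upper simp: abs_le_iff minus_le_iff)
  then have "totally_bdd (udist \<Phi> rdist) ((\<lambda>x \<phi>. \<phi> x) ` X)"
    by (rule totally_bdd_nonexp[OF U tb ext_pseudo_metric_rdist totally_bdd_rdist])
  then show ?thesis
    by (rule totally_bdd_isometric_vimage[OF U, rotated]) (simp add: D_pt_eq_udist)
qed

section \<open>Compactification of a perception pair\<close>

text \<open>
  Used to show that \<open>k\<close> is multiplicative and that \<open>i\<close> is compatible with the group actions: the two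
  sides agree on the dense image of \<open>A\<close>.
\<close>

lemma completion_compose_eq:
  assumes dA': "ext_pseudo_metric dA'" and dC': "ext_pseudo_metric dC'" and C': "separated dC' C'"
    and cA: "is_completion A dA A' dA' j" and f: "f \<in> A \<rightarrow> B"
    and f': "f' \<in> nonexp A' dA' B' dB'" and g': "g' \<in> nonexp B' dB' C' dC'"
    and h': "h' \<in> nonexp A' dA' C' dC'" "h' \<in> extensional A'"
    and "\<And>x. x \<in> A \<Longrightarrow> f' (j x) = b (f x)" "\<And>y. y \<in> B \<Longrightarrow> g' (b y) = c (g y)"
      "\<And>x. x \<in> A \<Longrightarrow> h' (j x) = c (g (f x))"
  shows "h' = compose A' g' f'"
proof (rule nonexp_eq_on_dense[OF dA' dC' C' cA h' nonexp_compose[OF f' g'] compose_extensional])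
  fix x assume "x \<in> A"
  then show "h' (j x) = compose A' g' f' (j x)"
    using assms(10-) funcset_mem[OF f] is_completionD(1)[OF cA] by (simp add: compose_def)
qed

text \<open>
  The distances \<open>D_data\<close>, \<open>D_Aut\<close> and \<open>D_GENEO\<close> agree with uniform distances on the carriers only, whence
  the second pair of distances \<open>e\<close> and \<open>e'\<close>.
\<close>

lemma completion_is_compactification:
  assumes c: "is_completion A d A' d' j" and tb: "totally_bdd d A" and sep: "separated d A"
    and d': "ext_pseudo_metric d'"
    and e: "\<And>x y. x \<in> A \<Longrightarrow> y \<in> A \<Longrightarrow> d x y = e x y"
    and e': "\<And>x y. x \<in> A' \<Longrightarrow> y \<in> A' \<Longrightarrow> d' x y = e' x y"
  shows "dense_isometric_embedding A e A' e' j" "epm_compact A' e'"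
proof -
  have top: "epm_topology A' d' = epm_topology A' e'" using e' by (rule epm_topology_cong)
  have "dense_isometric_embedding A d A' d' j"
    by (rule is_completion_imp_dense_isometric_embedding[OF c sep d'])
  then show "dense_isometric_embedding A e A' e' j"
    using e e' unfolding dense_isometric_embedding_def top by (auto simp: Pi_iff)
  show "epm_compact A' e'"
    using is_completion_imp_epm_compact(1)[OF c tb d'] unfolding epm_compact_def top .
qed

lemma epm_is_metric_imp_separated:
  assumes "epm_is_metric S d" shows "separated d S"
proof -
  interpret Metric_space S "\<lambda>x y. enn2real (d x y)" using assms by (simp add: epm_is_metric_def)
  show ?thesis unfolding separated_def using zero by (metis enn2real_0)
qed


text \<open>
  The metric core of a compactification, before compactness is taken into account.
\<close>

locale completed_perception_pair =
  fixes X :: "'x set" and \<Phi> G and X' :: "'z set" and \<Phi>' G' j i k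
  assumes pp: "perception_pair X \<Phi> G" and pp': "perception_pair X' \<Phi>' G'"
    and cX: "is_completion X (D_pt \<Phi>) X' (D_pt \<Phi>') j"
    and c\<Phi>: "is_completion \<Phi> (udist X rdist) \<Phi>' (udist X' rdist) i"
    and cG: "is_completion G (udist X (D_pt \<Phi>)) G' (udist X' (D_pt \<Phi>')) k"
    and i_j: "\<And>\<phi> x. \<phi> \<in> \<Phi> \<Longrightarrow> x \<in> X \<Longrightarrow> i \<phi> (j x) = \<phi> x"
    and k_j: "\<And>g x. g \<in> G \<Longrightarrow> x \<in> X \<Longrightarrow> k g (j x) = j (g x)"
begin

lemma G_funcset: "g \<in> G \<Longrightarrow> g \<in> X \<rightarrow> X" and G'_funcset: "h \<in> G' \<Longrightarrow> h \<in> X' \<rightarrow> X'"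
  using perception_pairD(2)[OF pp] perception_pairD(2)[OF pp'] Bij_imp_funcset by blast+

lemma G'_nonexp: "g \<in> G' \<Longrightarrow> g \<in> nonexp X' (D_pt \<Phi>') X' (D_pt \<Phi>')"
  using perception_group_nonexp[OF pp'] by blast

lemma \<Phi>'_nonexp: "\<phi> \<in> \<Phi>' \<Longrightarrow> \<phi> \<in> nonexp X' (D_pt \<Phi>') UNIV rdist"
  using data_nonexp by blast

lemma k_mem: "g \<in> G \<Longrightarrow> k g \<in> G'" and i_mem: "\<phi> \<in> \<Phi> \<Longrightarrow> i \<phi> \<in> \<Phi>'"
  using is_completionD(1)[OF cG] is_completionD(1)[OF c\<Phi>] by blast+

lemma k_compose:
  assumes g: "g \<in> G" and h: "h \<in> G"
  shows "k (compose X g h) = compose X' (k g) (k h)"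
proof (rule completion_compose_eq[OF ext_pseudo_metric_D_pt ext_pseudo_metric_D_pt
      is_completionD(5)[OF cX] cX G_funcset[OF h] G'_nonexp[OF k_mem[OF h]] G'_nonexp[OF k_mem[OF g]]])
  have gh: "compose X g h \<in> G" by (rule perception_pairD(4)[OF pp g h])
  show "k (compose X g h) \<in> nonexp X' (D_pt \<Phi>') X' (D_pt \<Phi>')" by (rule G'_nonexp[OF k_mem[OF gh]])
  show "k (compose X g h) \<in> extensional X'"
    using k_mem[OF gh] perception_pairD(2)[OF pp'] Bij_imp_extensional by blast
  show "k (compose X g h) (j x) = j (g (h x))" if "x \<in> X" for x
    using k_j[OF gh that] that by (simp add: compose_def)
qed (use k_j g h in auto)

lemma i_compose:
  assumes \<phi>: "\<phi> \<in> \<Phi>" and g: "g \<in> G"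
  shows "i (compose X \<phi> g) = compose X' (i \<phi>) (k g)"
proof (rule completion_compose_eq[where c = "\<lambda>x. x", OF ext_pseudo_metric_D_pt ext_pseudo_metric_rdist
      is_completionD(5)[OF is_completion_rdist] cX G_funcset[OF g] G'_nonexp[OF k_mem[OF g]]
      \<Phi>'_nonexp[OF i_mem[OF \<phi>]]])
  have gh: "compose X \<phi> g \<in> \<Phi>" by (rule perception_pairD(6)[OF pp \<phi> g])
  show "i (compose X \<phi> g) \<in> nonexp X' (D_pt \<Phi>') UNIV rdist" by (rule \<Phi>'_nonexp[OF i_mem[OF gh]])
  show "i (compose X \<phi> g) \<in> extensional X'"
    using i_mem[OF gh] perception_pairD(1)[OF pp'] by (auto simp: data_set_iff)
  show "i (compose X \<phi> g) (j x) = \<phi> (g x)" if "x \<in> X" for x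
    using i_j[OF gh that] that by (simp add: compose_def)
qed (use k_j i_j g \<phi> in auto)

lemma compose_group_less:
  assumes "g \<in> G'" "h \<in> G'" "g' \<in> G'" "h' \<in> G'"
    and "udist X' (D_pt \<Phi>') h h' < ennreal a" "udist X' (D_pt \<Phi>') g g' < ennreal b"
  shows "udist X' (D_pt \<Phi>') (compose X' g h) (compose X' g' h') < ennreal (a + b)"
  by (rule udist_compose_less[OF ext_pseudo_metric_D_pt G'_funcset[OF assms(2)] G'_funcset[OF assms(4)]
    G'_nonexp[OF assms(3)] assms(5,6)])

lemma compose_data_less:
  assumes "h \<in> G'" "\<phi>' \<in> \<Phi>'" "h' \<in> G'"
    and "udist X' (D_pt \<Phi>') h h' < ennreal a" "udist X' rdist \<phi> \<phi>' < ennreal b"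
  shows "udist X' rdist (compose X' \<phi> h) (compose X' \<phi>' h') < ennreal (a + b)"
  by (rule udist_compose_less[OF ext_pseudo_metric_rdist G'_funcset[OF assms(1)] G'_funcset[OF assms(3)]
    \<Phi>'_nonexp[OF assms(2)] assms(4)])
    (use assms(5) in simp)

lemma perception_pair_compactification:
  assumes tb: "totally_bdd (udist X rdist) \<Phi>" and sep: "separated (D_pt \<Phi>) X"
  shows "perception_pair_compactification X \<Phi> G X' \<Phi>' G' j i k"
proof -
  note E = ext_pseudo_metric_D_pt and R = ext_pseudo_metric_rdist and U = ext_pseudo_metric_udist
  note D = perception_pairD(1)[OF pp] and D' = perception_pairD(1)[OF pp']
  have tbX: "totally_bdd (D_pt \<Phi>) X" by (rule totally_bdd_points[OF D tb])
  have tbG: "totally_bdd (udist X (D_pt \<Phi>)) G"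
    by (rule totally_bdd_nonexp[OF E tbX E tbX perception_group_nonexp[OF pp]])
  have "dense_isometric_embedding X (D_pt \<Phi>) X' (D_pt \<Phi>') j" "epm_compact X' (D_pt \<Phi>')"
    by (rule completion_is_compactification[OF cX tbX sep E refl refl]; assumption)+
  moreover have "dense_isometric_embedding \<Phi> (D_data X) \<Phi>' (D_data X') i" "epm_compact \<Phi>' (D_data X')"
    by (rule completion_is_compactification[OF c\<Phi> tb separated_data[OF D] U[OF R]
      D_data_eq_udist[OF D, symmetric] D_data_eq_udist[OF D', symmetric]]; assumption)+
  moreover have "dense_isometric_embedding G (D_Aut X \<Phi>) G' (D_Aut X' \<Phi>') k" "epm_compact G' (D_Aut X' \<Phi>')"
    by (rule completion_is_compactification[OF cG tbG separated_perception_group[OF pp sep] U[OF E]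
      D_Aut_eq_udist[OF pp, symmetric] D_Aut_eq_udist[OF pp', symmetric]]; assumption)+
  ultimately show ?thesis
    using pp' i_j k_j by (simp add: perception_pair_compactification_def compact_perception_pair_def)
qed

end

text \<open>
  The Kuratowski completion comes with its own metric \<open>U\<close>. It coincides with the metric \<open>D_pt \<Phi>'\<close>
  induced by the extended functions: both are continuous and they agree on the image of \<open>X\<close>. Inverses
  in \<open>G'\<close> come from extending the inversion of \<open>G\<close>, which is nonexpansive because left and right
  translations are isometries.
\<close>

lemma perception_pair_completion:
  fixes X :: "'x set"
  assumes pp: "perception_pair X \<Phi> G" and fin: "\<And>x y. x \<in> X \<Longrightarrow> y \<in> X \<Longrightarrow> D_pt \<Phi> x y < \<infinity>"
  obtains X' :: "('x \<Rightarrow> real) set" and \<Phi>' G' j i k where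
    "completed_perception_pair X \<Phi> G X' \<Phi>' G' j i k"
proof -
  note P = perception_pairD[OF pp]
  note E = ext_pseudo_metric_D_pt and R = ext_pseudo_metric_rdist
  note epm_U = ext_pseudo_metric_udist
  define U :: "('x \<Rightarrow> real) \<Rightarrow> ('x \<Rightarrow> real) \<Rightarrow> ennreal" where "U = udist X rdist"
  interpret U: ext_pseudo_metric U unfolding U_def by (rule epm_U[OF R])
  obtain X' j where cU: "is_completion X (D_pt \<Phi>) X' U j"
    unfolding U_def by (rule kuratowski_completion[OF E fin])
  define \<Phi>' where "\<Phi>' = map_closure X X' U j UNIV rdist (\<lambda>x. x) \<Phi>"
  obtain i where ci: "is_completion \<Phi> (udist X rdist) \<Phi>' (udist X' rdist) i"
    and ij: "\<And>\<phi> x. \<phi> \<in> \<Phi> \<Longrightarrow> x \<in> X \<Longrightarrow> i \<phi> (j x) = \<phi> x"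
    unfolding \<Phi>'_def
    by (rule map_closure_is_completion[OF U.ext_pseudo_metric_axioms R cU is_completion_rdist data_nonexp]) blast
  have D_le: "D_pt \<Phi>' y z \<le> U y z" if "y \<in> X'" "z \<in> X'" for y z
    unfolding D_pt_eq_udist
  proof (rule udist_least)
    fix \<phi> assume \<phi>: "\<phi> \<in> \<Phi>'"
    show "rdist (\<phi> y) (\<phi> z) \<le> U y z"
      by (rule nonexp_le[OF map_closureD(2)[OF \<phi>[unfolded \<Phi>'_def]] that])
  qed
  have D_j: "D_pt \<Phi> x x' \<le> D_pt \<Phi>' (j x) (j x')" if x: "x \<in> X" and x': "x' \<in> X" for x x'
    unfolding D_pt_eq_udist[of \<Phi>]
  proof (rule udist_least)
    fix \<phi> assume \<phi>: "\<phi> \<in> \<Phi>"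
    have "rdist (\<phi> x) (\<phi> x') = rdist (i \<phi> (j x)) (i \<phi> (j x'))" using ij \<phi> x x' by simp
    also have "\<dots> \<le> D_pt \<Phi>' (j x) (j x')" by (rule rdist_le_D_pt[OF is_completionD(1)[OF ci \<phi>]])
    finally show "rdist (\<phi> x) (\<phi> x') \<le> D_pt \<Phi>' (j x) (j x')" .
  qed
  interpret D: ext_pseudo_metric "D_pt \<Phi>'" by (rule E)
  \<comment> \<open>Replacing \<open>y\<close> and \<open>z\<close> by nearby points of \<open>X\<close> costs at most \<open>e/4\<close> for each of the two points in
    each of the two metrics.\<close>
  have D_pt': "U y z = D_pt \<Phi>' y z" if y: "y \<in> X'" and z: "z \<in> X'" for y z
  proof (rule antisym[OF _ D_le[OF y z]], rule ennreal_le_epsilon)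
    fix e :: real assume e: "e > 0"
    then have e4: "e/4 > 0" by simp
    obtain a where a: "a \<in> X" "U y (j a) < ennreal (e/4)" by (rule is_completion_approx[OF cU y e4])
    obtain b where b: "b \<in> X" "U z (j b) < ennreal (e/4)" by (rule is_completion_approx[OF cU z e4])
    have ja: "j a \<in> X'" and jb: "j b \<in> X'" using is_completionD(1)[OF cU] a b by auto
    have "U y z \<le> U y (j a) + U (j a) (j b) + U (j b) z" by (rule U.tri4)
    also have "U (j a) (j b) = D_pt \<Phi> a b" by (rule is_completionD(2)[OF cU a(1) b(1)])
    also have "\<dots> \<le> D_pt \<Phi>' (j a) (j b)" by (rule D_j[OF a(1) b(1)])
    also have "\<dots> \<le> D_pt \<Phi>' (j a) y + D_pt \<Phi>' y z + D_pt \<Phi>' z (j b)" by (rule D.tri4)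
    also have "D_pt \<Phi>' (j a) y \<le> ennreal (e/4)"
      using D_le[OF y ja] a(2) D.sym[of y] by (metis less_imp_le order_trans)
    also have "D_pt \<Phi>' z (j b) \<le> ennreal (e/4)"
      using D_le[OF z jb] b(2) by (metis less_imp_le order_trans)
    also have "U y (j a) \<le> ennreal (e/4)" using a(2) by (rule less_imp_le)
    also have "U (j b) z \<le> ennreal (e/4)" using b(2) U.sym by (metis less_imp_le)
    finally have "U y z \<le> ennreal (e/4) + (ennreal (e/4) + D_pt \<Phi>' y z + ennreal (e/4)) + ennreal (e/4)"
      by (simp add: add_mono)
    also have "\<dots> = D_pt \<Phi>' y z + ((ennreal (e/4) + ennreal (e/4)) + (ennreal (e/4) + ennreal (e/4)))"
      by (simp add: ac_simps)
    also have "(ennreal (e/4) + ennreal (e/4)) + (ennreal (e/4) + ennreal (e/4)) = ennreal e"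
      using e by (simp flip: ennreal_plus)
    finally show "U y z \<le> D_pt \<Phi>' y z + ennreal e" .
  qed
  have cX: "is_completion X (D_pt \<Phi>) X' (D_pt \<Phi>') j"
    by (rule is_completion_cong[OF cU refl D_pt'])
  note X = is_completionD[OF cX]
  \<comment> \<open>From here on \<open>\<Phi>'\<close> is viewed as a closure with respect to its own point metric.\<close>
  have "nonexp X' U UNIV rdist = nonexp X' (D_pt \<Phi>') UNIV rdist"
    using D_pt' by (auto simp: nonexp_def)
  then have "\<Phi>' = map_closure X X' (D_pt \<Phi>') j UNIV rdist (\<lambda>x. x) \<Phi>"
    by (subst \<Phi>'_def) (simp add: map_closure_def)
  note \<Phi>'D = equalityD1[OF this, THEN subsetD] and \<Phi>'I = equalityD2[OF this, THEN subsetD]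
  define G' where "G' = map_closure X X' (D_pt \<Phi>') j X' (D_pt \<Phi>') j G"
  have GX: "G \<subseteq> X \<rightarrow> X" using P(2) Bij_imp_funcset by blast
  have jX: "j \<in> X \<rightarrow> X'" using X(1) by blast
  obtain k where ck: "is_completion G (udist X (D_pt \<Phi>)) G' (udist X' (D_pt \<Phi>')) k"
    and kj: "\<And>g x. g \<in> G \<Longrightarrow> x \<in> X \<Longrightarrow> k g (j x) = j (g x)"
    unfolding G'_def
    by (rule map_closure_is_completion[OF E E cX cX perception_group_nonexp[OF pp]]) blast
  have id': "(\<lambda>x\<in>X'. x) \<in> G'" unfolding G'_def
  proof (rule map_closureI)
    show "(\<lambda>x\<in>X'. x) \<in> nonexp X' (D_pt \<Phi>') X' (D_pt \<Phi>')" by (rule nonexpI) auto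
    interpret UX: ext_pseudo_metric "udist X (D_pt \<Phi>')" by (rule epm_U[OF E])
    have "udist X (D_pt \<Phi>') (\<lambda>x. (\<lambda>x\<in>X'. x) (j x)) (\<lambda>x. j ((\<lambda>x\<in>X. x) x)) = udist X (D_pt \<Phi>') j j"
      by (rule udist_cong) (use X(1) in auto)
    then show "\<exists>f\<in>G. udist X (D_pt \<Phi>') (\<lambda>x. (\<lambda>x\<in>X'. x) (j x)) (\<lambda>x. j (f x)) < ennreal e"
      if "e > 0" for e using that UX.refl by (intro bexI[OF _ P(3)]) simp
  qed simp
  have mult': "compose X' g h \<in> G'" if "g \<in> G'" "h \<in> G'" for g h
    using that unfolding G'_def by (intro map_closure_compose[OF E jX jX GX _ _ P(4)])
  have act': "compose X' \<phi> g \<in> \<Phi>'" if "\<phi> \<in> \<Phi>'" "g \<in> G'" for \<phi> g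
    using that(2)[unfolded G'_def] \<Phi>'D[OF that(1)]
    by (intro \<Phi>'I map_closure_compose[OF R jX jX GX _ _ P(6)])
  have G'E: "g \<in> X' \<rightarrow>\<^sub>E X'" if "g \<in> G'" for g
    by (rule map_closureD(1)[OF that[unfolded G'_def]])
  have G'n: "g \<in> nonexp X' (D_pt \<Phi>') X' (D_pt \<Phi>')" if "g \<in> G'" for g
    by (rule map_closureD(2)[OF that[unfolded G'_def]])
  have data': "data_set X' \<Phi>'"
    unfolding data_set_iff
  proof (intro conjI ballI)
    show "X' \<noteq> {}" using P(1) X(1) by (auto simp: data_set_iff)
    fix \<psi> assume \<psi>: "\<psi> \<in> \<Phi>'"
    show "\<psi> \<in> extensional X'" using map_closureD(1)[OF \<Phi>'D[OF \<psi>]] by (simp add: PiE_def)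
    obtain \<phi> where \<phi>: "\<phi> \<in> \<Phi>" "udist X rdist (\<lambda>x. \<psi> (j x)) (\<lambda>x. \<phi> x) < ennreal 1"
      using map_closureD(3)[OF \<Phi>'D[OF \<psi>], of 1] by auto
    have "bounded (\<phi> ` X)" using P(1) \<phi>(1) by (simp add: data_set_iff)
    then obtain M where M: "\<And>x. x \<in> X \<Longrightarrow> \<bar>\<phi> x\<bar> \<le> M"
      unfolding bounded_real by blast
    \<comment> \<open>One unit from \<open>y\<close> to a point of \<open>X\<close>, one from \<open>\<psi>\<close> to a function in \<open>\<Phi>\<close>.\<close>
    have "\<bar>\<psi> y\<bar> \<le> M + 2" if y: "y \<in> X'" for y
    proof -
      obtain x where x: "x \<in> X" "D_pt \<Phi>' y (j x) < ennreal 1"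
        by (rule is_completion_approx[OF cX y zero_less_one])
      have "rdist (\<psi> y) (\<psi> (j x)) < ennreal 1"
        using rdist_le_D_pt[OF \<psi>] x(2) by (rule order_le_less_trans)
      moreover have "rdist (\<psi> (j x)) (\<phi> x) < ennreal 1" by (rule udist_lessD[OF \<phi>(2) x(1)])
      ultimately show ?thesis using M[OF x(1)] unfolding rdist_less by linarith
    qed
    then show "bounded (\<psi> ` X')" unfolding bounded_real by blast
  qed
  interpret UG: ext_pseudo_metric "udist X' (D_pt \<Phi>')" by (rule epm_U[OF E])
  have inv': "\<exists>h\<in>G'. compose X' g h = (\<lambda>x\<in>X'. x) \<and> compose X' h g = (\<lambda>x\<in>X'. x)" if g: "g \<in> G'" for g
  proof -
    note K = is_completionD[OF ck]
    obtain v where v: "\<And>g. g \<in> G \<Longrightarrow> v g \<in> G" "\<And>g. g \<in> G \<Longrightarrow> compose X g (v g) = (\<lambda>x\<in>X. x)"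
      "\<And>g. g \<in> G \<Longrightarrow> compose X (v g) g = (\<lambda>x\<in>X. x)"
      using P(5) by metis
    have gX: "g x \<in> X" if "g \<in> G" "x \<in> X" for g x using GX that by auto
    have vr: "g (v g x) = x" and vl: "v g (g x) = x" if "g \<in> G" "x \<in> X" for g x
      using fun_cong[OF v(2)[OF that(1)], of x] fun_cong[OF v(3)[OF that(1)], of x] that(2)
      by (simp_all add: compose_def)
    interpret UG0: ext_pseudo_metric "udist X (D_pt \<Phi>)" by (rule epm_U[OF E])
    have "(\<lambda>g. k (v g)) \<in> nonexp G (udist X (D_pt \<Phi>)) G' (udist X' (D_pt \<Phi>'))"
    proof (rule nonexpI)
      show "k (v g) \<in> G'" if "g \<in> G" for g using K(1) v(1) that by blast
      fix g h assume g: "g \<in> G" and h: "h \<in> G"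
      have "udist X (D_pt \<Phi>) (v g) (v h) \<le> udist X (D_pt \<Phi>) h g"
      proof (rule udist_least)
        fix x assume x: "x \<in> X"
        \<comment> \<open>With \<open>x = h y\<close> the points \<open>v g x\<close> and \<open>v h x\<close> are the images of \<open>h y\<close> and \<open>g y\<close> under \<open>v g\<close>.\<close>
        define y where "y = v h x"
        have y: "y \<in> X" using gX[OF v(1)[OF h] x] by (simp add: y_def)
        have "v g \<in> nonexp X (D_pt \<Phi>) X (D_pt \<Phi>)" using perception_group_nonexp[OF pp] v(1)[OF g] by blast
        then have "D_pt \<Phi> (v g (h y)) (v g (g y)) \<le> D_pt \<Phi> (h y) (g y)"
          using gX g h y by (intro nonexp_le)
        also have "\<dots> \<le> udist X (D_pt \<Phi>) h g" using y by (rule udist_upper)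
        finally show "D_pt \<Phi> (v g x) (v h x) \<le> udist X (D_pt \<Phi>) h g"
          using vl[OF g y] vr[OF h x] by (simp add: y_def)
      qed
      then show "udist X' (D_pt \<Phi>') (k (v g)) (k (v h)) \<le> udist X (D_pt \<Phi>) g h"
        using K(2)[OF v(1)[OF g] v(1)[OF h]] UG0.sym[of g] by simp
    qed
    then obtain w where w: "w \<in> nonexp G' (udist X' (D_pt \<Phi>')) G' (udist X' (D_pt \<Phi>'))"
      and wk: "\<And>g. g \<in> G \<Longrightarrow> w (k g) = k (v g)"
      by (rule nonexp_extends_to_completion[OF UG.ext_pseudo_metric_axioms UG.ext_pseudo_metric_axioms ck K(4,5)])
        (rule that; assumption)
    have wg: "w g \<in> G'" using nonexp_mem[OF w g] .
    \<comment> \<open>Since \<open>k\<close> preserves mutually inverse pairs, \<open>w\<close> inverts the elements of the dense image of \<open>G\<close>;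
      by continuity it then inverts all of \<open>G'\<close>.\<close>
    have kk: "(\<lambda>x\<in>X'. x) = compose X' (k a) (k b)"
      if a: "a \<in> G" and b: "b \<in> G" and ab: "\<And>x. x \<in> X \<Longrightarrow> a (b x) = x" for a b
    proof (rule completion_compose_eq[OF E E X(5) cX])
      show "b \<in> X \<rightarrow> X" using GX b by auto
      show "k a \<in> nonexp X' (D_pt \<Phi>') X' (D_pt \<Phi>')" "k b \<in> nonexp X' (D_pt \<Phi>') X' (D_pt \<Phi>')"
        "(\<lambda>x\<in>X'. x) \<in> nonexp X' (D_pt \<Phi>') X' (D_pt \<Phi>')"
        using K(1) a b id' by (auto intro: G'n)
      show "k b (j x) = j (b x)" "k a (j x) = j (a x)" "(\<lambda>x\<in>X'. x) (j x) = j (a (b x))" if "x \<in> X" for x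
        using kj a b ab X(1) that by auto
    qed auto
    have close: "udist X' (D_pt \<Phi>') (compose X' g (w g)) (\<lambda>x\<in>X'. x) < ennreal e
        \<and> udist X' (D_pt \<Phi>') (compose X' (w g) g) (\<lambda>x\<in>X'. x) < ennreal e" if e: "e > 0" for e
    proof -
      obtain a where a: "a \<in> G" "udist X' (D_pt \<Phi>') g (k a) < ennreal (e/2)"
        by (rule is_completion_approx[OF ck g, of "e/2"]) (use e in auto)
      have ka: "k a \<in> G'" and kv: "k (v a) \<in> G'" using K(1) a v(1) by auto
      have 2: "udist X' (D_pt \<Phi>') (w g) (k (v a)) < ennreal (e/2)"
        using nonexp_less[OF w g ka, OF a(2)] wk[OF a(1)] by simp
      have fs: "f \<in> X' \<rightarrow> X'" if "f \<in> G'" for f using G'E[OF that] by auto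
      have "udist X' (D_pt \<Phi>') (compose X' g (w g)) (compose X' (k a) (k (v a))) < ennreal (e/2 + e/2)"
        using udist_compose_less[OF E fs[OF wg] fs[OF kv] G'n[OF ka] 2 a(2)] .
      moreover have "udist X' (D_pt \<Phi>') (compose X' (w g) g) (compose X' (k (v a)) (k a)) < ennreal (e/2 + e/2)"
        using udist_compose_less[OF E fs[OF g] fs[OF ka] G'n[OF kv] a(2) 2] .
      ultimately show ?thesis
        using kk[OF a(1) v(1)[OF a(1)] vr[OF a(1)]] kk[OF v(1)[OF a(1)] a(1) vl[OF a(1)]] by simp
    qed
    have "udist X' (D_pt \<Phi>') (compose X' g (w g)) (\<lambda>x\<in>X'. x) = 0"
      "udist X' (D_pt \<Phi>') (compose X' (w g) g) (\<lambda>x\<in>X'. x) = 0"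
      using close UG.refl by (auto intro!: UG.eq_0I exI[of _ "\<lambda>x\<in>X'. x"])
    then have "compose X' g (w g) = (\<lambda>x\<in>X'. x)" "compose X' (w g) g = (\<lambda>x\<in>X'. x)"
      using K(5) mult'[OF g wg] mult'[OF wg g] id' by (auto simp: separated_def)
    then show ?thesis using wg by blast
  qed
  have "perception_pair X' \<Phi>' G'"
    using G'E by (intro perception_pairI data' id' mult' inv' act') auto
  then have "completed_perception_pair X \<Phi> G X' \<Phi>' G' j i k"
    using pp cX ci ck ij kj by (simp add: completed_perception_pair_def)
  then show thesis by (rule that)
qed

section \<open>Compactification of a space of operators\<close>

lemma geneos_nonexp:
  assumes "data_set X \<Phi>" "data_set Y \<Psi>"
  shows "geneos X \<Phi> G Y \<Psi> T = {F \<in> \<Phi> \<rightarrow>\<^sub>E \<Psi>. F \<in> nonexp \<Phi> (udist X rdist) \<Psi> (udist Y rdist) \<and>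
    (\<forall>\<phi>\<in>\<Phi>. \<forall>g\<in>G. F (compose X \<phi> g) = compose Y (F \<phi>) (T g))}"
  using D_data_eq_udist[OF assms(1)] D_data_eq_udist[OF assms(2)]
  by (auto simp: geneos_def nonexp_def PiE_iff)

text \<open>
  Collectionwise surjectivity lets the supremum over \<open>\<Psi>\<close> run over the functions \<open>F \<phi>\<close>, for which
  equivariance turns the action of \<open>T g\<close> into the action of \<open>g\<close> on \<open>\<phi>\<close>.
\<close>

lemma collectionwise_surjective_imp_nonexp_hom:
  assumes ppX: "perception_pair X \<Phi> G" and ppY: "perception_pair Y \<Psi> H"
    and T: "T \<in> G \<rightarrow> H" and F: "\<F> \<subseteq> geneos X \<Phi> G Y \<Psi> T"
    and surj: "collectionwise_surjective \<Phi> \<Psi> \<F>"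
  shows "T \<in> nonexp G (udist X (D_pt \<Phi>)) H (udist Y (D_pt \<Psi>))"
proof (rule nonexpI)
  show "T g \<in> H" if "g \<in> G" for g using T that by blast
  fix g h assume g: "g \<in> G" and h: "h \<in> G"
  have "D_Aut Y \<Psi> (T g) (T h) \<le> D_Aut X \<Phi> g h"
    unfolding D_Aut_def[of Y]
  proof (rule SUP_least)
    fix \<psi> assume "\<psi> \<in> \<Psi>"
    then obtain F \<phi> where F\<phi>: "F \<in> \<F>" "\<phi> \<in> \<Phi>" "\<psi> = F \<phi>"
      using surj by (auto simp: collectionwise_surjective_def)
    then have eq: "compose Y \<psi> (T g) = F (compose X \<phi> g)" "compose Y \<psi> (T h) = F (compose X \<phi> h)"
      using F g h by (auto simp: geneos_def)
    have "D_data Y (F (compose X \<phi> g)) (F (compose X \<phi> h)) \<le> D_data X (compose X \<phi> g) (compose X \<phi> h)"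
      using F F\<phi>(1) perception_pairD(6)[OF ppX F\<phi>(2)] g h by (auto simp: geneos_def)
    also have "\<dots> \<le> D_Aut X \<Phi> g h" unfolding D_Aut_def by (rule SUP_upper[OF F\<phi>(2)])
    finally show "D_data Y (compose Y \<psi> (T g)) (compose Y \<psi> (T h)) \<le> D_Aut X \<Phi> g h"
      unfolding eq .
  qed
  then show "udist Y (D_pt \<Psi>) (T g) (T h) \<le> udist X (D_pt \<Phi>) g h"
    using D_Aut_eq_udist[OF ppX g h] D_Aut_eq_udist[OF ppY funcset_mem[OF T g] funcset_mem[OF T h]] by simp
qed


locale two_completed_perception_pairs =
  P: completed_perception_pair X \<Phi> G X' \<Phi>' G' j1 i1 k1 +
  Q: completed_perception_pair Y \<Psi> H Y' \<Psi>' H' j2 i2 k2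
  for X :: "'x set" and \<Phi> G and X' :: "'z set" and \<Phi>' G' j1 i1 k1
    and Y :: "'y set" and \<Psi> H and Y' :: "'w set" and \<Psi>' H' j2 i2 k2
begin

text \<open>
  Both \<open>T' (g h)\<close> and \<open>T' g T' h\<close> are approximated by \<open>k2 (T (a b))\<close>, where \<open>a\<close> and \<open>b\<close> in \<open>G\<close> approximate
  \<open>g\<close> and \<open>h\<close>.
\<close>

lemma hom_extends_to_completion:
  assumes T: "T \<in> hom (perception_group X \<Phi> G) (perception_group Y \<Psi> H)"
    and Tn: "T \<in> nonexp G (udist X (D_pt \<Phi>)) H (udist Y (D_pt \<Psi>))"
  obtains T' where "T' \<in> hom (perception_group X' \<Phi>' G') (perception_group Y' \<Psi>' H')"
    "T' \<in> nonexp G' (udist X' (D_pt \<Phi>')) H' (udist Y' (D_pt \<Psi>'))"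
    "\<And>g. g \<in> G \<Longrightarrow> T' (k1 g) = k2 (T g)"
proof -
  interpret DG: ext_pseudo_metric "udist X' (D_pt \<Phi>')" by (rule ext_pseudo_metric_udist[OF ext_pseudo_metric_D_pt])
  interpret DH: ext_pseudo_metric "udist Y' (D_pt \<Psi>')" by (rule ext_pseudo_metric_udist[OF ext_pseudo_metric_D_pt])
  have TH: "T \<in> G \<rightarrow> H" and Tmult: "\<And>g h. g \<in> G \<Longrightarrow> h \<in> G \<Longrightarrow> T (compose X g h) = compose Y (T g) (T h)"
    using T unfolding hom_perception_group_iff[OF P.pp Q.pp] by blast+
  have "(\<lambda>g. k2 (T g)) \<in> nonexp G (udist X (D_pt \<Phi>)) H' (udist Y' (D_pt \<Psi>'))"
  proof (rule nonexpI)
    show "k2 (T g) \<in> H'" if "g \<in> G" for g by (rule Q.k_mem[OF nonexp_mem[OF Tn that]])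
    show "udist Y' (D_pt \<Psi>') (k2 (T g)) (k2 (T h)) \<le> udist X (D_pt \<Phi>) g h"
      if g: "g \<in> G" and h: "h \<in> G" for g h
      unfolding is_completionD(2)[OF Q.cG nonexp_mem[OF Tn g] nonexp_mem[OF Tn h]]
      by (rule nonexp_le[OF Tn g h])
  qed
  then obtain T' where T'n: "T' \<in> nonexp G' (udist X' (D_pt \<Phi>')) H' (udist Y' (D_pt \<Psi>'))"
    and T'k: "\<And>g. g \<in> G \<Longrightarrow> T' (k1 g) = k2 (T g)"
    by (rule nonexp_extends_to_completion[OF DG.ext_pseudo_metric_axioms DH.ext_pseudo_metric_axioms
          P.cG is_completionD(4,5)[OF Q.cG]]) (rule that; assumption)
  note T'm = nonexp_mem[OF T'n]
  have T'mult: "T' (compose X' g h) = compose Y' (T' g) (T' h)" if g: "g \<in> G'" and h: "h \<in> G'" for g h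
  proof -
    have gh: "compose X' g h \<in> G'" by (rule perception_pairD(4)[OF P.pp' g h])
    have "udist Y' (D_pt \<Psi>') (T' (compose X' g h)) (compose Y' (T' g) (T' h)) = 0"
    proof (rule DH.eq_0I)
      fix e :: real assume e: "e > 0"
      then have e2: "e/2 > 0" by simp
      obtain a where a: "a \<in> G" "udist X' (D_pt \<Phi>') g (k1 a) < ennreal (e/2)"
        by (rule is_completion_approx[OF P.cG g e2])
      obtain b where b: "b \<in> G" "udist X' (D_pt \<Phi>') h (k1 b) < ennreal (e/2)"
        by (rule is_completion_approx[OF P.cG h e2])
      note ka = P.k_mem[OF a(1)] and kb = P.k_mem[OF b(1)]
      have ab: "compose X a b \<in> G" by (rule perception_pairD(4)[OF P.pp a(1) b(1)])
      define w where "w = k2 (T (compose X a b))"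
      have w: "w = compose Y' (T' (k1 a)) (T' (k1 b))"
        using Tmult[OF a(1) b(1)] Q.k_compose[OF funcset_mem[OF TH a(1)] funcset_mem[OF TH b(1)]]
          T'k[OF a(1)] T'k[OF b(1)] by (simp add: w_def)
      have "udist X' (D_pt \<Phi>') (compose X' g h) (k1 (compose X a b)) < ennreal (e/2 + e/2)"
        unfolding P.k_compose[OF a(1) b(1)] by (rule P.compose_group_less[OF g h ka kb b(2) a(2)])
      then have "udist Y' (D_pt \<Psi>') (T' (compose X' g h)) (T' (k1 (compose X a b))) < ennreal (e/2 + e/2)"
        by (rule nonexp_less[OF T'n gh P.k_mem[OF ab]])
      then have "udist Y' (D_pt \<Psi>') (T' (compose X' g h)) w < ennreal e"
        using T'k[OF ab] by (simp add: w_def)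
      moreover have "udist Y' (D_pt \<Psi>') (compose Y' (T' g) (T' h)) w < ennreal (e/2 + e/2)"
        unfolding w
        by (rule Q.compose_group_less[OF T'm[OF g] T'm[OF h] T'm[OF ka] T'm[OF kb]
              nonexp_less[OF T'n h kb, OF b(2)] nonexp_less[OF T'n g ka, OF a(2)]])
      ultimately show "\<exists>w. udist Y' (D_pt \<Psi>') (T' (compose X' g h)) w < ennreal e \<and>
          udist Y' (D_pt \<Psi>') (compose Y' (T' g) (T' h)) w < ennreal e" by auto
    qed
    then show ?thesis
      using is_completionD(5)[OF Q.cG] T'm[OF gh] perception_pairD(4)[OF Q.pp' T'm[OF g] T'm[OF h]]
      by (simp add: separated_def)
  qed
  have T'hom: "T' \<in> hom (perception_group X' \<Phi>' G') (perception_group Y' \<Psi>' H')"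
    unfolding hom_perception_group_iff[OF P.pp' Q.pp'] using T'm T'mult by blast
  then show thesis using T'n T'k by (rule that)
qed

text \<open>
  Only equivariance needs an argument. Both sides of it are approximated by \<open>i2 (F0 (\<phi>0 a))\<close>, where \<open>F0\<close>,
  \<open>\<phi>0\<close> and \<open>a\<close> approximate the operator, the function and the group element.
\<close>

lemma map_closure_subset_geneos:
  assumes FT: "\<F> \<subseteq> geneos X \<Phi> G Y \<Psi> T" and TH: "T \<in> G \<rightarrow> H"
    and T'n: "T' \<in> nonexp G' (udist X' (D_pt \<Phi>')) H' (udist Y' (D_pt \<Psi>'))"
    and T'k: "\<And>g. g \<in> G \<Longrightarrow> T' (k1 g) = k2 (T g)"
  shows "map_closure \<Phi> \<Phi>' (udist X' rdist) i1 \<Psi>' (udist Y' rdist) i2 \<F> \<subseteq> geneos X' \<Phi>' G' Y' \<Psi>' T'"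
proof -
  note D'X = perception_pairD(1)[OF P.pp'] and D'Y = perception_pairD(1)[OF Q.pp']
  note T'm = nonexp_mem[OF T'n]
  interpret D\<Psi>: ext_pseudo_metric "udist Y' rdist" by (rule ext_pseudo_metric_udist[OF ext_pseudo_metric_rdist])
  have F: "F \<in> nonexp \<Phi> (udist X rdist) \<Psi> (udist Y rdist)" "F \<in> \<Phi> \<rightarrow>\<^sub>E \<Psi>"
    "\<And>\<phi> g. \<phi> \<in> \<Phi> \<Longrightarrow> g \<in> G \<Longrightarrow> F (compose X \<phi> g) = compose Y (F \<phi>) (T g)" if "F \<in> \<F>" for F
    using that FT unfolding geneos_nonexp[OF perception_pairD(1)[OF P.pp] perception_pairD(1)[OF Q.pp]] by auto
  define \<F>' where "\<F>' = map_closure \<Phi> \<Phi>' (udist X' rdist) i1 \<Psi>' (udist Y' rdist) i2 \<F>"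
  have F'n: "F \<in> nonexp \<Phi>' (udist X' rdist) \<Psi>' (udist Y' rdist)" and F'E: "F \<in> \<Phi>' \<rightarrow>\<^sub>E \<Psi>'" if "F \<in> \<F>'" for F
    by (rule map_closureD(2)[OF that[unfolded \<F>'_def]], rule map_closureD(1)[OF that[unfolded \<F>'_def]])
  have equiv: "F (compose X' \<phi> g) = compose Y' (F \<phi>) (T' g)"
    if F': "F \<in> \<F>'" and \<phi>: "\<phi> \<in> \<Phi>'" and g: "g \<in> G'" for F \<phi> g
  proof -
    note F'm = nonexp_mem[OF F'n[OF F']]
    have \<phi>g: "compose X' \<phi> g \<in> \<Phi>'" by (rule perception_pairD(6)[OF P.pp' \<phi> g])
    have "udist Y' rdist (F (compose X' \<phi> g)) (compose Y' (F \<phi>) (T' g)) = 0"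
    proof (rule D\<Psi>.eq_0I)
      fix e :: real assume e: "e > 0"
      then have e3: "e/3 > 0" by simp
      obtain \<phi>0 where \<phi>0: "\<phi>0 \<in> \<Phi>" "udist X' rdist \<phi> (i1 \<phi>0) < ennreal (e/3)"
        by (rule is_completion_approx[OF P.c\<Phi> \<phi> e3])
      obtain a where a: "a \<in> G" "udist X' (D_pt \<Phi>') g (k1 a) < ennreal (e/3)"
        by (rule is_completion_approx[OF P.cG g e3])
      obtain F0 where F0: "F0 \<in> \<F>"
        "udist \<Phi> (udist Y' rdist) (\<lambda>\<theta>. F (i1 \<theta>)) (\<lambda>\<theta>. i2 (F0 \<theta>)) < ennreal (e/3)"
        using map_closureD(3)[OF F'[unfolded \<F>'_def] e3] by blast
      note i\<phi>0 = P.i_mem[OF \<phi>0(1)] and ka = P.k_mem[OF a(1)]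
      have \<phi>a: "compose X \<phi>0 a \<in> \<Phi>" by (rule perception_pairD(6)[OF P.pp \<phi>0(1) a(1)])
      have F0\<phi>0: "F0 \<phi>0 \<in> \<Psi>" by (rule nonexp_mem[OF F(1)[OF F0(1)] \<phi>0(1)])
      have Ta: "T a \<in> H" by (rule funcset_mem[OF TH a(1)])
      define w where "w = i2 (F0 (compose X \<phi>0 a))"
      have w: "w = compose Y' (i2 (F0 \<phi>0)) (k2 (T a))"
        using F(3)[OF F0(1) \<phi>0(1) a(1)] Q.i_compose[OF F0\<phi>0 Ta] by (simp add: w_def)
      have F_F0: "udist Y' rdist (F (i1 \<theta>)) (i2 (F0 \<theta>)) < ennreal (e/3)" if "\<theta> \<in> \<Phi>" for \<theta>
        by (rule udist_lessD[OF F0(2) that])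
      have "udist X' rdist (compose X' \<phi> g) (i1 (compose X \<phi>0 a)) < ennreal (e/3 + e/3)"
        unfolding P.i_compose[OF \<phi>0(1) a(1)] by (rule P.compose_data_less[OF g i\<phi>0 ka a(2) \<phi>0(2)])
      then have "udist Y' rdist (F (compose X' \<phi> g)) (F (i1 (compose X \<phi>0 a))) < ennreal (e/3 + e/3)"
        by (rule nonexp_less[OF F'n[OF F'] \<phi>g P.i_mem[OF \<phi>a]])
      then have *: "udist Y' rdist (F (compose X' \<phi> g)) w < ennreal (e/3 + e/3 + e/3)"
        unfolding w_def using F_F0[OF \<phi>a] by (rule D\<Psi>.tri_less)
      have "udist Y' rdist (F \<phi>) (F (i1 \<phi>0)) < ennreal (e/3)"
        by (rule nonexp_less[OF F'n[OF F'] \<phi> i\<phi>0, OF \<phi>0(2)])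
      then have "udist Y' rdist (F \<phi>) (i2 (F0 \<phi>0)) < ennreal (e/3 + e/3)"
        using F_F0[OF \<phi>0(1)] by (rule D\<Psi>.tri_less)
      moreover have "udist Y' (D_pt \<Psi>') (T' g) (k2 (T a)) < ennreal (e/3)"
        using nonexp_less[OF T'n g ka, OF a(2)] T'k[OF a(1)] by simp
      ultimately have "udist Y' rdist (compose Y' (F \<phi>) (T' g)) w < ennreal (e/3 + (e/3 + e/3))"
        unfolding w by (intro Q.compose_data_less[OF T'm[OF g] Q.i_mem[OF F0\<phi>0] Q.k_mem[OF Ta]])
      with * show "\<exists>w. udist Y' rdist (F (compose X' \<phi> g)) w < ennreal e \<and>
          udist Y' rdist (compose Y' (F \<phi>) (T' g)) w < ennreal e" by auto
    qed
    then show ?thesis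
      using is_completionD(5)[OF Q.c\<Phi>] F'm[OF \<phi>g] perception_pairD(6)[OF Q.pp' F'm[OF \<phi>] T'm[OF g]]
      by (simp add: separated_def)
  qed
  show ?thesis
    unfolding \<F>'_def[symmetric]
    unfolding geneos_nonexp[OF D'X D'Y] using F'n F'E equiv by blast
qed

end

theorem theorem47:
  fixes X :: "'x set" and \<Phi> :: "('x \<Rightarrow> real) set" and G :: "('x \<Rightarrow> 'x) set"
    and Y :: "'y set" and \<Psi> :: "('y \<Rightarrow> real) set" and H :: "('y \<Rightarrow> 'y) set"
    and T :: "('x \<Rightarrow> 'x) \<Rightarrow> ('y \<Rightarrow> 'y)"
    and \<F> :: "(('x \<Rightarrow> real) \<Rightarrow> ('y \<Rightarrow> real)) set"
  assumes "perception_pair X \<Phi> G"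
    and "perception_pair Y \<Psi> H"
    and "T \<in> hom (perception_group X \<Phi> G) (perception_group Y \<Psi> H)"
    and "\<F> \<subseteq> geneos X \<Phi> G Y \<Psi> T"
    and "collectionwise_surjective \<Phi> \<Psi> \<F>"
    and "data_totally_bounded X \<Phi>"
    and "data_totally_bounded Y \<Psi>"
    and "epm_is_metric X (D_pt \<Phi>)"
    and "epm_is_metric Y (D_pt \<Psi>)"
  shows "admits_compactification X \<Phi> G Y \<Psi> H T \<F>"
proof -
  note pX = assms(1) and pY = assms(2)
  note DX = perception_pairD(1)[OF pX] and DY = perception_pairD(1)[OF pY]
  note U = ext_pseudo_metric_udist and R = ext_pseudo_metric_rdist and E = ext_pseudo_metric_D_pt
  note tbX = totally_bdd_data[OF DX assms(6)] and tbY = totally_bdd_data[OF DY assms(7)]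
  have finX: "D_pt \<Phi> x x' < \<infinity>" if "x \<in> X" "x' \<in> X" for x x'
    using assms(8) that by (simp add: epm_is_metric_def)
  have finY: "D_pt \<Psi> y y' < \<infinity>" if "y \<in> Y" "y' \<in> Y" for y y'
    using assms(9) that by (simp add: epm_is_metric_def)
  obtain X' :: "('x \<Rightarrow> real) set" and \<Phi>' G' j1 i1 k1 where
    cpX: "completed_perception_pair X \<Phi> G X' \<Phi>' G' j1 i1 k1"
    by (rule perception_pair_completion[OF pX finX])
  obtain Y' :: "('y \<Rightarrow> real) set" and \<Psi>' H' j2 i2 k2 where
    cpY: "completed_perception_pair Y \<Psi> H Y' \<Psi>' H' j2 i2 k2"
    by (rule perception_pair_completion[OF pY finY])
  interpret P: completed_perception_pair X \<Phi> G X' \<Phi>' G' j1 i1 k1 by (rule cpX)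
  interpret Q: completed_perception_pair Y \<Psi> H Y' \<Psi>' H' j2 i2 k2 by (rule cpY)
  note D'X = perception_pairD(1)[OF P.pp'] and D'Y = perception_pairD(1)[OF Q.pp']
  interpret PQ: two_completed_perception_pairs X \<Phi> G X' \<Phi>' G' j1 i1 k1 Y \<Psi> H Y' \<Psi>' H' j2 i2 k2
    by unfold_locales
  have TH: "T \<in> G \<rightarrow> H"
    using assms(3) unfolding hom_perception_group_iff[OF pX pY] by blast
  have Tn: "T \<in> nonexp G (udist X (D_pt \<Phi>)) H (udist Y (D_pt \<Psi>))"
    by (rule collectionwise_surjective_imp_nonexp_hom[OF pX pY TH assms(4,5)])
  obtain T' where T'hom: "T' \<in> hom (perception_group X' \<Phi>' G') (perception_group Y' \<Psi>' H')"
    and T'n: "T' \<in> nonexp G' (udist X' (D_pt \<Phi>')) H' (udist Y' (D_pt \<Psi>'))"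
    and T'k: "\<And>g. g \<in> G \<Longrightarrow> T' (k1 g) = k2 (T g)"
    by (rule PQ.hom_extends_to_completion[OF assms(3) Tn]) (rule that; assumption)
  have F: "F \<in> nonexp \<Phi> (udist X rdist) \<Psi> (udist Y rdist)" "F \<in> \<Phi> \<rightarrow>\<^sub>E \<Psi>" if "F \<in> \<F>" for F
    using that assms(4) unfolding geneos_nonexp[OF DX DY] by auto
  define \<F>' where "\<F>' = map_closure \<Phi> \<Phi>' (udist X' rdist) i1 \<Psi>' (udist Y' rdist) i2 \<F>"
  have Fsub: "\<F> \<subseteq> nonexp \<Phi> (udist X rdist) \<Psi> (udist Y rdist)" using F(1) by blast
  obtain f where f: "is_completion \<F> (udist \<Phi> (udist Y rdist)) \<F>' (udist \<Phi>' (udist Y' rdist)) f"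
    and fi: "\<And>F \<phi>. F \<in> \<F> \<Longrightarrow> \<phi> \<in> \<Phi> \<Longrightarrow> f F (i1 \<phi>) = i2 (F \<phi>)"
    unfolding \<F>'_def by (rule map_closure_is_completion[OF U[OF R] U[OF R] P.c\<Phi> Q.c\<Phi> Fsub]) blast
  have F'sub: "\<F>' \<subseteq> geneos X' \<Phi>' G' Y' \<Psi>' T'"
    unfolding \<F>'_def by (rule PQ.map_closure_subset_geneos[OF assms(4) TH T'n T'k])
  then have F'm: "F \<phi> \<in> \<Psi>'" if "F \<in> \<F>'" "\<phi> \<in> \<Phi>'" for F \<phi>
    using that by (auto simp: geneos_def)
  have tbF: "totally_bdd (udist \<Phi> (udist Y rdist)) \<F>"
    by (rule totally_bdd_nonexp[OF U[OF R] tbX U[OF R] tbY Fsub])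
  have sepF: "separated (udist \<Phi> (udist Y rdist)) \<F>"
    by (rule separated_subset[OF separated_udist[OF separated_data[OF DY]]]) (use F(2) in blast)
  have D: "udist \<Phi> (udist Y rdist) F1 F2 = D_GENEO \<Phi> Y F1 F2" if "F1 \<in> \<F>" "F2 \<in> \<F>" for F1 F2
    unfolding D_GENEO_def udist_def[symmetric]
    using F(2) that D_data_eq_udist[OF DY] by (intro udist_cong) (auto simp: PiE_iff)
  have D': "udist \<Phi>' (udist Y' rdist) F1 F2 = D_GENEO \<Phi>' Y' F1 F2" if "F1 \<in> \<F>'" "F2 \<in> \<F>'" for F1 F2
    unfolding D_GENEO_def udist_def[symmetric]
    using F'm that D_data_eq_udist[OF D'Y] by (intro udist_cong) auto
  have emb: "dense_isometric_embedding \<F> (D_GENEO \<Phi> Y) \<F>' (D_GENEO \<Phi>' Y') f" "epm_compact \<F>' (D_GENEO \<Phi>' Y')"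
    by (rule completion_is_compactification[OF f tbF sepF U[OF U[OF R]] D D']; assumption)+
  have sepX: "separated (D_pt \<Phi>) X" and sepY: "separated (D_pt \<Psi>) Y"
    using epm_is_metric_imp_separated assms(8,9) by blast+
  have "perception_pair_compactification X \<Phi> G X' \<Phi>' G' j1 i1 k1"
    by (rule P.perception_pair_compactification[OF tbX sepX])
  moreover have "perception_pair_compactification Y \<Psi> H Y' \<Psi>' H' j2 i2 k2"
    by (rule Q.perception_pair_compactification[OF tbY sepY])
  moreover have "\<forall>F\<in>\<F>. \<forall>\<phi>\<in>\<Phi>. i2 (F \<phi>) = f F (i1 \<phi>)" "\<forall>g\<in>G. k2 (T g) = T' (k1 g)"
    using fi T'k by simp_all
  ultimately have "geneo_space_compactification X \<Phi> G Y \<Psi> H T \<F> X' \<Phi>' G' Y' \<Psi>' H' T' \<F>'"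
    unfolding geneo_space_compactification_def using T'hom F'sub emb by blast
  then show ?thesis unfolding admits_compactification_def by blast
qed

end
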